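(* Assume the setting described in the context, where $(X_i,Y_i)_{i=1}^n$ is stationary $\beta$-mixing with coefficients $\beta(\cdot)$. Let $\alpha\in(0,1)$, $\delta_{\mathrm{cal}}>0$, $\delta_{\mathrm{test}}>0$, and define $\widetilde{\sigma}(a)=\sqrt{\frac14+\frac{2}{a}\sum_{j=1}^{a-1}(a-j)\beta(j)}$, \[\varepsilon_{\mathrm{cal}}=\inf_{(a,m,r)\in F_{\mathrm{cal}}}\left\{\widetilde{\sigma}(a)\sqrt{\frac{4}{n_{\mathrm{cal}}-r+1}\log\left(\frac{4}{\delta_{\mathrm{cal}}-4(m-1)\beta(a)-\beta(r)}\right)}+\frac{1}{3m}\log\left(\frac{4}{\delta_{\mathrm{cal}}-4(m-1)\beta(a)-\beta(r)}\right)+\frac{r-1}{n_{\mathrm{cal}}}\right\},\] with $F_{\mathrm{cal}}=\{(a,m,r)\in\mathbb{N}_{>0}^3: 2ma=n_{\mathrm{cal}}-r+1,\ \delta_{\mathrm{cal}}>4(m-1)\beta(a)+\beta(r)\}$, and \[\varepsilon_{\mathrm{test}}=\inf_{(a,m,s)\in F_{\mathrm{test}}}\left\{\widetilde{\sigma}(a)\sqrt{\frac{4}{n_{\mathrm{test}}}\log\left(\frac{4}{\delta_{\mathrm{test}}-4(m-1)\beta(a)-\beta(n_{\mathrm{cal}})}\right)}+\frac{1}{3m}\log\left(\frac{4}{\delta_{\mathrm{test}}-4(m-1)\beta(a)-\beta(n_{\mathrm{cal}})}\right)+\frac{s}{n_{\mathrm{test}}}\right\},\] with $F_{\mathrm{test}}=\{(a,m,s)\in\mathbb{N}_{>0}^2\times\mathbb{N}: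 2ma=n_{\mathrm{test}}-s,\ \delta_{\mathrm{test}}>4(m-1)\beta(a)+\beta(n_{\mathrm{cal}})\}$. Let $\eta=\varepsilon_{\mathrm{cal}}+\varepsilon_{\mathrm{test}}$. Then \[\mathbb{P}\left[\frac{1}{n_{\mathrm{test}}}\sum_{i\in I_{\mathrm{test}}}\mathbf{1}\{Y_i\in C_{1-\alpha}(X_i)\}\ge 1-\alpha-\eta\right]\ge 1-\delta_{\mathrm{cal}}-\delta_{\mathrm{test}}.\] Additionally, if $\widehat{s}_{\mathrm{train}}(X_*,Y_* )$ almost surely has a continuous distribution conditionally on the training data, then \[\mathbb{P}\left[\left|\frac{1}{n_{\mathrm{test}}}\sum_{i\in I_{\mathrm{test}}}\mathbf{1}\{Y_i\in C_{1-\alpha}(X_i)\}-(1-\alpha)\right|\le\eta\right]\ge 1-2\delta_{\mathrm{cal}}-2\delta_{\mathrm{test}}.\]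
   Context: Let $\mathcal{X},\mathcal{Y}$ be measurable spaces. A stochastic process $\{Z_t\}_{t\in\mathbb{Z}}$ is stationary if its finite-dimensional distributions are shift-invariant; its $\beta$-mixing coefficient at $a\in\mathbb{N}$ is $\beta(a)=\|\mathbb{P}_{-\infty:0,a:\infty}-\mathbb{P}_{-\infty:0}\otimes\mathbb{P}_{a:\infty}\|_{\mathrm{TV}}$ (total variation distance between the joint law of the blocks $(Z_{-\infty:0},Z_{a:\infty})$ and the product of their laws), and the process is $\beta$-mixing if $\beta(a)\to0$. "The sample $(X_i,Y_i)_{i=1}^n$ is stationary $\beta$-mixing" means $(X_i,Y_i)=Z_i$, $i=1,\dots,n$, for such a process with values in $\mathcal{X}\times\mathcal{Y}$. Let $(X_*,Y_* )$ be independent of the sample with $(X_*,Y_* )\sim(X_1,Y_1)$. Write $n=n_{\mathrm{train}}+n_{\mathrm{cal}}+n_{\mathrm{test}}$ with positive integers, $I_{\mathrm{train}}=\{1,\dots,n_{\mathrm{train}}\}$, $I_{\mathrm{cal}}=\{n_{\mathrm{train}}+1,\dots,n_{\mathrm{train}}+n_{\mathrm{cal}}\}$, $I_{\mathrm{test}}=\{n_{\mathrm{train}}+n_{\mathrm{cal}}+1,\dots,n\}$. Let $s:(\mathcal{X}\times\mathcal{Y})^{n_{\mathrm{train}}+1}\to\mathbb{R}$ be any (measurable) function and $\widehat{s}_{\mathrm{train}}(x,y)=s((X_i,Y_i)_{i\in I_{\mathrm{train}}},(x,y))$. For $\phi\in[0,1)$, $\widehat{q}_{\phi,\mathrm{cal}}=\inf\{t\in\mathbb{R}:\frac{1}{n_{\mathrm{cal}}}\sum_{i\in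 I_{\mathrm{cal}}}\mathbf{1}\{\widehat{s}_{\mathrm{train}}(X_i,Y_i)\le t\}\ge\phi\}$ and $C_\phi(x)=\{y\in\mathcal{Y}:\widehat{s}_{\mathrm{train}}(x,y)\le\widehat{q}_{\phi,\mathrm{cal}}\}$. An infimum over the empty set is $+\infty$. *)

theory Defs
  imports "HOL-Probability.Probability"
begin

definition tv_dist :: "'a measure \<Rightarrow> 'a measure \<Rightarrow> real" where
  "tv_dist P Q = (SUP A \<in> sets P. \<bar>measure P A - measure Q A\<bar>)"

definition stationary_process ::
  "'a measure \<Rightarrow> 'z measure \<Rightarrow> (int \<Rightarrow> 'a \<Rightarrow> 'z) \<Rightarrow> bool" where
  "stationary_process M N Z \<longleftrightarrow>
     (\<forall>t. Z t \<in> measurable M N) \<and>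
     (\<forall>J k. finite J \<longrightarrow>
        distr M (PiM J (\<lambda>_. N)) (\<lambda>\<omega>. \<lambda>j\<in>J. Z (j + k) \<omega>)
        = distr M (PiM J (\<lambda>_. N)) (\<lambda>\<omega>. \<lambda>j\<in>J. Z j \<omega>))"

definition beta_coeff ::
  "'a measure \<Rightarrow> 'z measure \<Rightarrow> (int \<Rightarrow> 'a \<Rightarrow> 'z) \<Rightarrow> nat \<Rightarrow> real" where
  "beta_coeff M N Z a =
     (let Past = PiM {..0::int} (\<lambda>_. N);
          Fut  = PiM {int a..} (\<lambda>_. N);
          past = (\<lambda>\<omega>. \<lambda>j\<in>{..0::int}. Z j \<omega>);
          fut  = (\<lambda>\<omega>. \<lambda>j\<in>{int a..}. Z j \<omega>)
      in tv_dist (distr M (Past \<Otimes>\<^sub>M Fut) (\<lambda>\<omega>. (past \<omega>, fut \<omega>)))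
                 (distr M Past past \<Otimes>\<^sub>M distr M Fut fut))"

definition beta_mixing_process ::
  "'a measure \<Rightarrow> 'z measure \<Rightarrow> (int \<Rightarrow> 'a \<Rightarrow> 'z) \<Rightarrow> bool" where
  "beta_mixing_process M N Z \<longleftrightarrow>
     stationary_process M N Z \<and> (beta_coeff M N Z \<longlonglongrightarrow> 0)"

definition I_train :: "nat \<Rightarrow> int set" where
  "I_train ntr = {1 .. int ntr}"

definition I_cal :: "nat \<Rightarrow> nat \<Rightarrow> int set" where
  "I_cal ntr ncal = {int ntr + 1 .. int ntr + int ncal}"

definition I_test :: "nat \<Rightarrow> nat \<Rightarrow> nat \<Rightarrow> int set" where
  "I_test ntr ncal nte = {int ntr + int ncal + 1 .. int ntr + int ncal + int nte}"

definition s_hat ::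
  "((int \<Rightarrow> 'z) \<Rightarrow> 'z \<Rightarrow> real) \<Rightarrow> (int \<Rightarrow> 'a \<Rightarrow> 'z) \<Rightarrow> nat \<Rightarrow> 'a \<Rightarrow> 'z \<Rightarrow> real" where
  "s_hat s Z ntr \<omega> z = s (\<lambda>i\<in>I_train ntr. Z i \<omega>) z"

text \<open>Empirical calibration quantile (extended real; Inf of the empty set is +infinity).\<close>
definition q_cal ::
  "((int \<Rightarrow> 'z) \<Rightarrow> 'z \<Rightarrow> real) \<Rightarrow> (int \<Rightarrow> 'a \<Rightarrow> 'z) \<Rightarrow> nat \<Rightarrow> nat \<Rightarrow> real \<Rightarrow> 'a \<Rightarrow> ereal" where
  "q_cal s Z ntr ncal \<phi> \<omega> =
     Inf {ereal t | t. (1 / real ncal) * (\<Sum>i\<in>I_cal ntr ncal. of_bool (s_hat s Z ntr \<omega> (Z i \<omega>) \<le> t)) \<ge> \<phi>}"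

definition conf_set ::
  "(('x \<times> 'y) \<Rightarrow> real) \<Rightarrow> ereal \<Rightarrow> 'x \<Rightarrow> 'y set" where
  "conf_set sh q x = {y. ereal (sh (x, y)) \<le> q}"

definition test_coverage ::
  "((int \<Rightarrow> 'x \<times> 'y) \<Rightarrow> 'x \<times> 'y \<Rightarrow> real) \<Rightarrow> (int \<Rightarrow> 'a \<Rightarrow> 'x \<times> 'y)
     \<Rightarrow> nat \<Rightarrow> nat \<Rightarrow> nat \<Rightarrow> real \<Rightarrow> 'a \<Rightarrow> real" where
  "test_coverage s Z ntr ncal nte \<phi> \<omega> =
     (1 / real nte) * (\<Sum>i\<in>I_test ntr ncal nte.
        of_bool (snd (Z i \<omega>) \<in> conf_set (s_hat s Z ntr \<omega>) (q_cal s Z ntr ncal \<phi> \<omega>) (fst (Z i \<omega>))))"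

definition sigma_tilde :: "(nat \<Rightarrow> real) \<Rightarrow> nat \<Rightarrow> real" where
  "sigma_tilde \<beta> a = sqrt (1/4 + (2 / real a) * (\<Sum>j=1..<a. real (a - j) * \<beta> j))"

definition eps_cal :: "(nat \<Rightarrow> real) \<Rightarrow> nat \<Rightarrow> real \<Rightarrow> ereal" where
  "eps_cal \<beta> ncal \<delta> =
     Inf { ereal (sigma_tilde \<beta> a
                   * sqrt (4 / (real ncal - real r + 1)
                           * ln (4 / (\<delta> - 4 * (real m - 1) * \<beta> a - \<beta> r)))
                  + 1 / (3 * real m) * ln (4 / (\<delta> - 4 * (real m - 1) * \<beta> a - \<beta> r))
                  + (real r - 1) / real ncal)
         | a m r. a > 0 \<and> m > 0 \<and> r > 0 \<and>
                  int (2 * m * a) = int ncal - int r + 1 \<and>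
                  \<delta> > 4 * (real m - 1) * \<beta> a + \<beta> r }"

definition eps_test :: "(nat \<Rightarrow> real) \<Rightarrow> nat \<Rightarrow> nat \<Rightarrow> real \<Rightarrow> ereal" where
  "eps_test \<beta> ncal nte \<delta> =
     Inf { ereal (sigma_tilde \<beta> a
                   * sqrt (4 / real nte
                           * ln (4 / (\<delta> - 4 * (real m - 1) * \<beta> a - \<beta> ncal)))
                  + 1 / (3 * real m) * ln (4 / (\<delta> - 4 * (real m - 1) * \<beta> a - \<beta> ncal))
                  + real s / real nte)
         | a m s. a > 0 \<and> m > 0 \<and>
                  int (2 * m * a) = int nte - int s \<and>
                  \<delta> > 4 * (real m - 1) * \<beta> a + \<beta> ncal }"

end

theory Submission
  imports Defs
begin

text \<open>
  Let \<open>F\<^sub>d\<close> be the distribution function of the score under the stationary law, given training data \<open>d\<close>.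
  The threshold \<open>c = 1 - \<alpha> - \<epsilon>\<close>, with \<open>\<epsilon>\<close> the calibration error, singles out the sets
  \<open>{z. F\<^sub>d (s d z) \<le> c}\<close>, of probability at most \<open>c\<close>, and \<open>{z. F\<^sub>d (s d z -) < c}\<close>, of probability
  at least \<open>c\<close>. Both depend on the training data only. If the empirical frequency of the first in the
  calibration sample stays below \<open>1 - \<alpha>\<close>, then every test point in the second is covered, so the
  coverage is bounded below by an empirical frequency in the test sample; the upper bound is dual.

  For a set that depends on the training data only, the total variation bound replaces the joint law
  of training data and sample by the product law, at cost \<open>\<beta> r\<close>. The retained part of the sample is
  cut into \<open>2 m\<close> blocks of length \<open>a\<close>, and the odd and the even blocks are treated separately. The tail of
  a sum over \<open>m\<close> separated blocks is bounded by \<open>(m - 1) \<beta> a + exp (- \<theta> t) \<Gamma> ^ m\<close>, by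
  splitting off one block at a time, where \<open>\<Gamma>\<close> is a Bernstein bound on the moment generating function
  of a single block. Covariances inside a block are bounded by \<open>\<beta>\<close>, which yields the variance
  proxy \<open>a \<sigma>\<^sup>2\<close> with \<open>\<sigma> = sigma_tilde \<beta> a\<close>.
\<close>

section \<open>Bernstein's inequality\<close>

text \<open>Every factor after the first two is at least 3. This is what compares the tail of the
  exponential series with a geometric series of ratio \<open>y / 3\<close>.\<close>

lemma fact_ge_two_times_three_power: "2 * 3 ^ n \<le> (fact (n + 2) :: real)"
proof (induction n)
  case (Suc n)
  have "2 * 3 ^ Suc n = 3 * (2 * 3 ^ n :: real)" by simp
  also have "\<dots> \<le> real (n + 3) * fact (n + 2)"
    using Suc by (intro mult_mono) auto
  also have "\<dots> = fact (Suc n + 2)" by (simp add: algebra_simps)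
  finally show ?case .
qed (simp add: numeral_2_eq_2)

text \<open>From the quadratic term onwards the series is dominated by \<open>x\<^sup>2 / 2\<close>
  times the geometric series in \<open>y / 3\<close>; hence the condition \<open>y < 3\<close> and
  the Bernstein denominator.\<close>

lemma exp_le_quadratic:
  fixes x y :: real
  assumes "\<bar>x\<bar> \<le> y" "y < 3"
  shows "exp x \<le> 1 + x + x\<^sup>2 / (2 * (1 - y / 3))"
proof -
  define e where "e n = x ^ n / fact n" for n
  have e: "summable e" "suminf e = exp x"
    using summable_exp_generic[of x] by (simp_all add: e_def[abs_def] exp_def scaleR_conv_of_real divide_inverse mult.commute)
  have geo: "(\<lambda>n. x\<^sup>2 / 2 * (y / 3) ^ n) sums (x\<^sup>2 / 2 * (1 / (1 - y / 3)))"
    using assms by (intro sums_mult geometric_sums) auto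
  have "exp x = (\<Sum>n. e (n + 2)) + (\<Sum>n<2. e n)"
    using suminf_split_initial_segment[OF e(1), of 2] e(2) by simp
  also have "(\<Sum>n<2. e n) = 1 + x"
    by (simp add: e_def numeral_2_eq_2)
  also have "(\<Sum>n. e (n + 2)) \<le> (\<Sum>n. x\<^sup>2 / 2 * (y / 3) ^ n)"
  proof (intro suminf_le)
    fix n
    have "e (n + 2) \<le> \<bar>x\<bar> ^ (n + 2) / fact (n + 2)"
      unfolding e_def by (intro divide_right_mono) (simp_all only: power_abs[symmetric] abs_ge_self fact_ge_zero)
    also have "\<dots> \<le> \<bar>x\<bar> ^ (n + 2) / (2 * 3 ^ n)"
      using fact_ge_two_times_three_power[of n] by (intro divide_left_mono) auto
    also have "\<dots> = x\<^sup>2 / 2 * (\<bar>x\<bar> / 3) ^ n"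
      by (simp add: power_add power_divide power2_eq_square)
    also have "\<dots> \<le> x\<^sup>2 / 2 * (y / 3) ^ n"
      using assms by (intro mult_left_mono power_mono) auto
    finally show "e (n + 2) \<le> x\<^sup>2 / 2 * (y / 3) ^ n" .
  qed (use summable_ignore_initial_segment[OF e(1), of 2] geo in \<open>auto simp: sums_iff\<close>)
  also have "\<dots> = x\<^sup>2 / (2 * (1 - y / 3))"
    using geo by (simp add: sums_iff)
  finally show ?thesis by simp
qed

section \<open>Sums over lags and over alternating blocks\<close>

text \<open>The lag \<open>j\<close> occurs \<open>a - j\<close> times on each side of the diagonal.
  With \<open>c = 1/4\<close> and \<open>b = \<beta>\<close> the result is \<open>a\<close> times
  the square of \<open>sigma_tilde\<close>.\<close>

lemma sum_toeplitz:
  fixes b :: "nat \<Rightarrow> real"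
  shows "(\<Sum>i<a. \<Sum>j<a. if i = j then c else if i < j then b (j - i) else b (i - j))
       = real a * c + 2 * (\<Sum>j=1..<a. real (a - j) * b j)"
proof (induction a)
  case (Suc a)
  let ?h = "\<lambda>i j. if i = j then c else if i < j then b (j - i) else b (i - j)"
  have *: "(\<Sum>i<a. b (a - i)) = (\<Sum>j=1..a. b j)"
    by (rule sum.reindex_bij_witness[of _ "\<lambda>j. a - j" "\<lambda>i. a - i"]) auto
  have row: "(\<Sum>i<a. ?h i a) = (\<Sum>j=1..a. b j)" "(\<Sum>j<a. ?h a j) = (\<Sum>j=1..a. b j)"
    unfolding *[symmetric] by (auto intro!: sum.cong)
  have "(\<Sum>j=1..<Suc a. real (Suc a - j) * b j) = (\<Sum>j=1..<Suc a. real (a - j) * b j + b j)"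
    by (intro sum.cong) (auto simp: of_nat_diff algebra_simps)
  also have "\<dots> = (\<Sum>j=1..<a. real (a - j) * b j) + (\<Sum>j=1..a. b j)"
    by (simp add: sum.distrib atLeastLessThanSuc_atLeastAtMost) (cases a; simp add: atLeastLessThanSuc_atLeastAtMost)
  finally show ?case
    using Suc row by (simp add: sum.distrib algebra_simps)
qed simp

lemma sum_lessThan_add:
  fixes f :: "nat \<Rightarrow> 'b :: comm_monoid_add"
  shows "sum f {..<n + a} = sum f {..<n} + (\<Sum>i<a. f (n + i))"
  by (induction a) (simp_all add: add.assoc)

text \<open>Two families of \<open>m\<close> blocks of length \<open>a\<close>. Within each family
  consecutive blocks are a gap of length \<open>a\<close> apart, which mixing exploits.\<close>

lemma sum_alternating_blocks:
  fixes f :: "nat \<Rightarrow> 'b :: comm_monoid_add"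
  shows "sum f {..<2 * m * a} = (\<Sum>j<m. \<Sum>i<a. f (2 * a * j + i)) + (\<Sum>j<m. \<Sum>i<a. f (a + 2 * a * j + i))"
proof (induction m)
  case (Suc m)
  have "sum f {..<2 * Suc m * a} = sum f {..<(2 * m * a + a) + a}"
    by (intro arg_cong[where f = "sum f"]) (auto simp: algebra_simps)
  also have "\<dots> = sum f {..<2 * m * a} + (\<Sum>i<a. f (2 * a * m + i)) + (\<Sum>i<a. f (a + 2 * a * m + i))"
    by (simp only: sum_lessThan_add) (simp add: algebra_simps)
  finally show ?case unfolding Suc sum.lessThan_Suc by (simp only: ac_simps)
qed simp

text \<open>The choice \<open>\<theta> = u / (1 + c u)\<close> with \<open>u = sqrt (2 L / v)\<close> makes the sub-gamma Chernoff exponent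
  at \<open>sqrt (2 v L) + c L\<close> equal to \<open>-L\<close> exactly.\<close>

lemma sub_gamma_exponent:
  fixes v c L :: real
  assumes "0 < v" "0 < c" "0 < L"
  defines "\<theta> \<equiv> sqrt (2 * L / v) / (1 + c * sqrt (2 * L / v))"
  shows "0 < \<theta>" "\<theta> * c < 1" "- \<theta> * (sqrt (2 * v * L) + c * L) + \<theta>\<^sup>2 * v / (2 * (1 - \<theta> * c)) = - L"
proof -
  define u where "u = sqrt (2 * L / v)"
  have "0 < u" using assms by (simp add: u_def)
  have L: "L = v * u\<^sup>2 / 2" using assms by (simp add: u_def)
  have pos: "0 < 1 + c * u" using \<open>0 < u\<close> \<open>0 < c\<close> by (simp add: add_pos_pos)
  have \<theta>: "\<theta> = u / (1 + c * u)" by (simp add: \<theta>_def u_def)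
  show "0 < \<theta>" using \<open>0 < u\<close> pos by (simp add: \<theta>)
  show "\<theta> * c < 1" using pos by (simp add: \<theta> divide_simps ac_simps)
  have root: "sqrt (2 * v * L) = v * u"
    using \<open>0 < v\<close> \<open>0 < u\<close> by (intro real_sqrt_unique) (auto simp: L power2_eq_square)
  have "1 - \<theta> * c = 1 / (1 + c * u)" using pos by (simp add: \<theta> divide_simps)
  then have "\<theta>\<^sup>2 * v / (2 * (1 - \<theta> * c)) = v * u\<^sup>2 / (2 * (1 + c * u))"
    using pos by (simp add: \<theta> power2_eq_square) (simp add: ac_simps)
  moreover have "\<theta> * (sqrt (2 * v * L) + c * L) = (v * u\<^sup>2 + c * u * (v * u\<^sup>2) / 2) / (1 + c * u)"
    unfolding root unfolding \<theta> L times_divide_eq_left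
    by (rule arg_cong[where f = "\<lambda>x. x / (1 + c * u)"]) (simp add: power2_eq_square algebra_simps)
  moreover have "v * u\<^sup>2 + c * u * (v * u\<^sup>2) / 2 = v * u\<^sup>2 / 2 * (1 + (1 + c * u))"
    by (simp add: algebra_simps)
  moreover have "- (W * (1 + d) / d) + 2 * W / (2 * d) = - W" if "0 < d" for W d :: real
    using that by (simp add: field_simps)
  from this[OF pos, of "v * u\<^sup>2 / 2"]
  have "- (v * u\<^sup>2 / 2 * (1 + (1 + c * u)) / (1 + c * u)) + v * u\<^sup>2 / (2 * (1 + c * u)) = - (v * u\<^sup>2 / 2)"
    by simp
  ultimately show "- \<theta> * (sqrt (2 * v * L) + c * L) + \<theta>\<^sup>2 * v / (2 * (1 - \<theta> * c)) = - L"
    by (simp add: L)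
qed

section \<open>Moment generating functions and exponential tails\<close>

context prob_space
begin

text \<open>Integrating the quadratic bound on the exponential removes the linear term, as
  \<open>U\<close> is centred; \<open>1 + x \<le> exp x\<close> then restores an exponential, so
  that bounds for several blocks multiply.\<close>

lemma bernstein_mgf:
  fixes U :: "'a \<Rightarrow> real"
  assumes [measurable]: "U \<in> borel_measurable M" and bound: "\<And>\<omega>. \<bar>U \<omega>\<bar> \<le> b"
    and mean: "(\<integral>\<omega>. U \<omega> \<partial>M) = 0" and var: "(\<integral>\<omega>. (U \<omega>)\<^sup>2 \<partial>M) \<le> v"
    and "0 \<le> \<theta>" "\<theta> * b < 3"
  shows "(\<integral>\<omega>. exp (\<theta> * U \<omega>) \<partial>M) \<le> exp (\<theta>\<^sup>2 * v / (2 * (1 - \<theta> * b / 3)))"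
proof -
  define w where "w = 2 * (1 - \<theta> * b / 3)"
  have "w > 0" using assms by (simp add: w_def)
  have sq: "(U \<omega>)\<^sup>2 \<le> b\<^sup>2" for \<omega>
    using power_mono[OF bound abs_ge_zero, of \<omega> 2] by simp
  have U: "integrable M U" "integrable M (\<lambda>\<omega>. (U \<omega>)\<^sup>2)"
    using bound sq
    by (auto intro: integrable_const_bound[where B = b] integrable_const_bound[where B = "b\<^sup>2"])
  have "(\<integral>\<omega>. exp (\<theta> * U \<omega>) \<partial>M) \<le> (\<integral>\<omega>. 1 + \<theta> * U \<omega> + \<theta>\<^sup>2 / w * (U \<omega>)\<^sup>2 \<partial>M)"
  proof (intro integral_mono)
    have "\<bar>\<theta> * U \<omega>\<bar> \<le> \<theta> * b" for \<omega>
      using \<open>0 \<le> \<theta>\<close> bound by (auto simp: abs_mult intro: mult_left_mono)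
    then show "exp (\<theta> * U \<omega>) \<le> 1 + \<theta> * U \<omega> + \<theta>\<^sup>2 / w * (U \<omega>)\<^sup>2" for \<omega>
      using exp_le_quadratic[of "\<theta> * U \<omega>" "\<theta> * b"] \<open>\<theta> * b < 3\<close>
      by (simp add: w_def power_mult_distrib)
    from \<open>\<And>\<omega>. \<bar>\<theta> * U \<omega>\<bar> \<le> \<theta> * b\<close>
    show "integrable M (\<lambda>\<omega>. exp (\<theta> * U \<omega>))"
      by (intro integrable_const_bound[where B = "exp (\<theta> * b)"]) (auto intro: order_trans[OF abs_ge_self])
    show "integrable M (\<lambda>\<omega>. 1 + \<theta> * U \<omega> + \<theta>\<^sup>2 / w * (U \<omega>)\<^sup>2)" using U by auto
  qed
  also have "\<dots> = 1 + \<theta>\<^sup>2 / w * (\<integral>\<omega>. (U \<omega>)\<^sup>2 \<partial>M)"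
    using U by (simp add: mean prob_space)
  also have "\<dots> \<le> 1 + \<theta>\<^sup>2 / w * v"
    using var \<open>w > 0\<close> by (intro add_left_mono mult_left_mono) auto
  also have "\<dots> \<le> exp (\<theta>\<^sup>2 / w * v)" by (rule exp_ge_add_one_self)
  finally show ?thesis by (simp add: w_def)
qed

lemma markov_exp:
  fixes U :: "'a \<Rightarrow> real"
  assumes [measurable]: "U \<in> borel_measurable M" and bound: "\<And>\<omega>. \<bar>U \<omega>\<bar> \<le> b" and "0 < \<theta>"
  shows "prob {\<omega> \<in> space M. U \<omega> \<ge> t} \<le> exp (- \<theta> * t) * (\<integral>\<omega>. exp (\<theta> * U \<omega>) \<partial>M)"
proof -
  have int: "integrable M (\<lambda>\<omega>. exp (\<theta> * U \<omega>))"
    using bound \<open>0 < \<theta>\<close>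
    by (intro integrable_const_bound[where B = "exp (\<theta> * b)"])
       (auto intro!: mult_left_mono dest: abs_le_D1)
  then show ?thesis
    using Chernoff_ineq_ge[OF \<open>0 < \<theta>\<close>, of "space M" U t]
    by (simp add: set_lebesgue_integral_def set_integrable_def cong: Bochner_Integration.integrable_cong Bochner_Integration.integral_cong)
qed

end

section \<open>Distribution functions and quantiles\<close>

text \<open>The set is closed downwards, hence empty, the whole line, or a half-line with or without
  its endpoint. Accordingly its mass is zero, the limit at infinity, a value or a left limit of the
  cdf, each at most \<open>c\<close>. An atom may make the inequality strict.\<close>

lemma (in real_distribution) measure_cdf_le:
  assumes "0 \<le> c"
  shows "measure M {x. cdf M x \<le> c} \<le> c"
proof -
  define D where "D = {x. cdf M x \<le> c}"
  have down: "y \<in> D" if "x \<in> D" "y \<le> x" for x y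
    using cdf_nondecreasing[OF that(2)] that(1) by (simp add: D_def)
  have D_le: "cdf M x \<le> c" if "x \<in> D" for x using that by (simp add: D_def)
  consider "D = {}" | "\<not> bdd_above D" | "D \<noteq> {}" "bdd_above D" "Sup D \<in> D" | "D \<noteq> {}" "bdd_above D" "Sup D \<notin> D"
    by blast
  then have "measure M D \<le> c"
  proof cases
    case 2
    have "x \<in> D" for x using 2 down[of _ x] unfolding bdd_above_def by (meson linorder_le_cases)
    then have "eventually (\<lambda>x. cdf M x \<le> c) at_top" using D_le by simp
    moreover have "(cdf M \<longlongrightarrow> 1) at_top" by (rule cdf_lim_at_top_prob)
    ultimately have "1 \<le> c" by (intro tendsto_upperbound) auto
    then show ?thesis using prob_le_1[of D] by linarith
  next
    case 3
    then have "D = {..Sup D}" using down by (auto intro: cSup_upper)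
    then show ?thesis using D_le[OF 3(3)] by (simp add: cdf_def)
  next
    case 4
    have D: "D = {..<Sup D}"
    proof (intro set_eqI iffI)
      fix x assume "x \<in> {..<Sup D}"
      then obtain y where "y \<in> D" "x < y" using 4 by (auto simp: less_cSup_iff)
      then show "x \<in> D" using down[of y x] by simp
    next
      fix x assume "x \<in> D"
      then have "x \<le> Sup D" "x \<noteq> Sup D" using 4 by (auto intro: cSup_upper)
      then show "x \<in> {..<Sup D}" by simp
    qed
    \<comment> \<open>The endpoint is excluded, so the mass of the half-line is the left limit of
      the cdf at \<open>Sup D\<close>.\<close>
    have "eventually (\<lambda>x. cdf M x \<le> c) (at_left (Sup D))"
      using D D_le unfolding eventually_at_left_field by (metis lessThan_iff lt_ex)
    then have "measure M {..<Sup D} \<le> c"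
      using cdf_at_left by (intro tendsto_upperbound) auto
    then show ?thesis using D by simp
  qed (use assms in auto)
  then show ?thesis by (simp add: D_def)
qed

context prob_space
begin

lemma prob_cdf_transform_le:
  fixes X :: "'a \<Rightarrow> real"
  assumes [measurable]: "random_variable borel X" and "0 \<le> c"
  shows "prob {\<omega> \<in> space M. prob {\<omega>' \<in> space M. X \<omega>' \<le> X \<omega>} \<le> c} \<le> c"
proof -
  interpret D: real_distribution "distr M borel X" by (rule real_distribution_distr) simp
  have cdf: "cdf (distr M borel X) x = prob {\<omega>' \<in> space M. X \<omega>' \<le> x}" for x
    by (simp add: cdf_def measure_distr vimage_def Int_def conj_commute)
  have "{x. cdf (distr M borel X) x \<le> c} \<in> sets borel"
    using borel_measurable_mono[OF monoI[OF D.cdf_nondecreasing]] by measurable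
  then show ?thesis
    using D.measure_cdf_le[OF \<open>0 \<le> c\<close>]
    by (simp add: measure_distr cdf vimage_def Int_def conj_commute)
qed

text \<open>Reflection: for \<open>- X\<close> and the level \<open>1 - c\<close> the previous bound
  speaks of the complementary event, because the cdf of \<open>- X\<close> at \<open>- x\<close> is
  \<open>1 - G x\<close>.\<close>

lemma prob_cdf_transform_less:
  fixes X :: "'a \<Rightarrow> real"
  assumes [measurable]: "random_variable borel X" and "c \<le> 1"
  shows "c \<le> prob {\<omega> \<in> space M. prob {\<omega>' \<in> space M. X \<omega>' < X \<omega>} < c}"
proof -
  define G where "G x = prob {\<omega>' \<in> space M. X \<omega>' < x}" for x
  have "mono G" unfolding G_def by (intro monoI finite_measure_mono) auto
  then have [measurable]: "G \<in> borel_measurable borel" by (rule borel_measurable_mono)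
  have G_compl: "prob {\<omega>' \<in> space M. - X \<omega>' \<le> - x} = 1 - G x" for x
    unfolding G_def by (subst prob_compl[symmetric]) (auto intro!: arg_cong[where f = prob])
  have "1 - prob {\<omega> \<in> space M. G (X \<omega>) < c} = prob {\<omega> \<in> space M. 1 - G (X \<omega>) \<le> 1 - c}"
    by (subst prob_compl[symmetric]) (auto intro!: arg_cong[where f = prob])
  also have "\<dots> \<le> 1 - c"
    using prob_cdf_transform_le[of "\<lambda>\<omega>. - X \<omega>" "1 - c"] \<open>c \<le> 1\<close> by (simp only: G_compl) simp
  finally show ?thesis by (simp add: G_def)
qed

end

section \<open>The empirical quantile as a comparison of counts\<close>

text \<open>If the scores strictly below \<open>x\<close> already had frequency \<phi>, the largest
  of them would be an admissible \<open>t\<close> below \<open>x\<close>. Conversely, any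
  \<open>t\<close> below \<open>x\<close> counts at most those scores. Scores tied with
  \<open>x\<close> are thus not counted.\<close>

lemma le_q_cal_iff:
  assumes "0 < \<phi>"
  shows "ereal x \<le> q_cal s Z ntr ncal \<phi> \<omega> \<longleftrightarrow>
    (1 / real ncal) * (\<Sum>i\<in>I_cal ntr ncal. of_bool (s_hat s Z ntr \<omega> (Z i \<omega>) < x)) < \<phi>"
    (is "_ \<longleftrightarrow> ?G < \<phi>")
proof -
  define sc where "sc i = s_hat s Z ntr \<omega> (Z i \<omega>)" for i
  define I where "I = I_cal ntr ncal"
  define F where "F t = (1 / real ncal) * (\<Sum>i\<in>I. of_bool (sc i \<le> t))" for t
  have fin: "finite I" by (simp add: I_def I_cal_def)
  have q: "q_cal s Z ntr ncal \<phi> \<omega> = Inf {ereal t | t. F t \<ge> \<phi>}"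
    by (simp add: q_cal_def F_def sc_def I_def)
  have "(\<forall>t. F t \<ge> \<phi> \<longrightarrow> x \<le> t) \<longleftrightarrow> ?G < \<phi>"
  proof
    assume *: "\<forall>t. F t \<ge> \<phi> \<longrightarrow> x \<le> t"
    show "?G < \<phi>"
    proof (rule ccontr)
      assume "\<not> ?G < \<phi>"
      define T where "T = {sc i | i. i \<in> I \<and> sc i < x}"
      have "finite T" using fin by (simp add: T_def)
      \<comment> \<open>Positivity of \<phi> enters here: an empty \<open>T\<close> would give
        frequency zero.\<close>
      moreover have "T \<noteq> {}"
      proof
        assume "T = {}"
        then have "(\<Sum>i\<in>I_cal ntr ncal. of_bool (s_hat s Z ntr \<omega> (Z i \<omega>) < x)) = (0 :: real)"
          by (auto simp: T_def I_def sc_def intro!: sum.neutral)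
        with \<open>\<not> ?G < \<phi>\<close> \<open>0 < \<phi>\<close> show False by simp
      qed
      ultimately have "Max T \<in> T" by (rule Max_in)
      then have "Max T < x" by (auto simp: T_def)
      have "sc i \<le> Max T" if "i \<in> I" "sc i < x" for i
        using that by (intro Max_ge[OF \<open>finite T\<close>]) (auto simp: T_def)
      then have "?G \<le> F (Max T)"
        unfolding F_def I_def[symmetric] sc_def[symmetric]
        by (intro mult_left_mono sum_mono) auto
      with \<open>\<not> ?G < \<phi>\<close> * have "x \<le> Max T" by simp
      with \<open>Max T < x\<close> show False by simp
    qed
  next
    assume *: "?G < \<phi>"
    show "\<forall>t. F t \<ge> \<phi> \<longrightarrow> x \<le> t"
    proof (intro allI impI, rule ccontr)
      fix t assume "F t \<ge> \<phi>" "\<not> x \<le> t"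
      have "F t \<le> ?G"
        unfolding F_def I_def[symmetric] sc_def[symmetric] using \<open>\<not> x \<le> t\<close>
        by (intro mult_left_mono sum_mono) auto
      with * \<open>F t \<ge> \<phi>\<close> show False by simp
    qed
  qed
  then show ?thesis by (auto simp: q le_Inf_iff)
qed

text \<open>Coverage becomes a double count of strict score comparisons, so the possibly infinite
  quantile need not be treated as a random variable.\<close>

lemma test_coverage_eq:
  assumes "0 < \<phi>"
  shows "test_coverage s Z ntr ncal nte \<phi> \<omega> = (1 / real nte) * (\<Sum>j\<in>I_test ntr ncal nte.
    of_bool ((1 / real ncal) * (\<Sum>i\<in>I_cal ntr ncal.
      of_bool (s_hat s Z ntr \<omega> (Z i \<omega>) < s_hat s Z ntr \<omega> (Z j \<omega>))) < \<phi>))"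
  by (simp add: test_coverage_def conf_set_def le_q_cal_iff[OF assms])

section \<open>Decoupling\<close>

locale stationary_sequence = prob_space M for M :: "'a measure" +
  fixes N :: "'z measure" and Z :: "int \<Rightarrow> 'a \<Rightarrow> 'z"
  assumes stationary: "stationary_process M N Z"
begin

abbreviation \<beta> :: "nat \<Rightarrow> real" where "\<beta> \<equiv> beta_coeff M N Z"

text \<open>Undefined outside \<open>J\<close>, as membership in \<open>PiM J\<close> demands. For
  the two half-lines of times it is the past and the future in \<open>beta_coeff\<close>.\<close>

definition window :: "int set \<Rightarrow> 'a \<Rightarrow> int \<Rightarrow> 'z" where
  "window J \<omega> = (\<lambda>j\<in>J. Z j \<omega>)"

lemma measurable_Z [measurable]: "Z t \<in> measurable M N"
  using stationary by (simp add: stationary_process_def)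

lemma measurable_window [measurable]: "window J \<in> measurable M (PiM J (\<lambda>_. N))"
  unfolding window_def by measurable

lemma window_apply: "j \<in> J \<Longrightarrow> window J \<omega> j = Z j \<omega>"
  by (simp add: window_def)

lemma restrict_window: "J \<subseteq> K \<Longrightarrow> restrict (window K \<omega>) J = window J \<omega>"
  by (auto simp: window_def restrict_def fun_eq_iff)

text \<open>Over the reals, a member is below the supremum only once the family is known to be
  bounded; differences of probabilities are bounded by 1.\<close>

lemma beta_coeff_upper:
  assumes "C \<in> sets (PiM {..0} (\<lambda>_. N) \<Otimes>\<^sub>M PiM {int r..} (\<lambda>_. N))"
  shows "\<bar>measure (distr M (PiM {..0} (\<lambda>_. N) \<Otimes>\<^sub>M PiM {int r..} (\<lambda>_. N))
             (\<lambda>\<omega>. (window {..0} \<omega>, window {int r..} \<omega>))) C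
           - measure (distr M (PiM {..0} (\<lambda>_. N)) (window {..0}) \<Otimes>\<^sub>M
                      distr M (PiM {int r..} (\<lambda>_. N)) (window {int r..})) C\<bar> \<le> \<beta> r"
proof -
  define P where "P = distr M (PiM {..0} (\<lambda>_. N) \<Otimes>\<^sub>M PiM {int r..} (\<lambda>_. N))
             (\<lambda>\<omega>. (window {..0} \<omega>, window {int r..} \<omega>))"
  define Q where "Q = distr M (PiM {..0} (\<lambda>_. N)) (window {..0}) \<Otimes>\<^sub>M
                      distr M (PiM {int r..} (\<lambda>_. N)) (window {int r..})"
  have P: "prob_space P" unfolding P_def by (intro prob_space_distr) measurable
  have Q: "prob_space Q" unfolding Q_def
    by (intro prob_space_pair prob_space_distr) measurable
  have beta: "\<beta> r = (SUP A\<in>sets P. \<bar>measure P A - measure Q A\<bar>)"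
    by (simp add: beta_coeff_def tv_dist_def P_def Q_def Let_def window_def[abs_def])
  have "bdd_above ((\<lambda>A. \<bar>measure P A - measure Q A\<bar>) ` sets P)"
  proof (rule bdd_aboveI2)
    fix A
    show "\<bar>measure P A - measure Q A\<bar> \<le> 1"
      using prob_space.prob_le_1[OF P, of A] prob_space.prob_le_1[OF Q, of A]
        measure_nonneg[of P A] measure_nonneg[of Q A] by linarith
  qed
  moreover have "C \<in> sets P" using assms by (simp add: P_def)
  ultimately show ?thesis
    unfolding beta P_def[symmetric] Q_def[symmetric] by (intro cSUP_upper)
qed

lemma beta_nonneg: "0 \<le> \<beta> r"
  by (rule order_trans[OF abs_ge_zero beta_coeff_upper[of "{}"]]) simp

text \<open>Fubini for an indicator. The product law becomes a probability over a fresh copy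
  \<omega>' with \<omega> frozen, the form in which decoupled probabilities are written
  below.\<close>

lemma measure_pair_eq_integral:
  assumes "C \<in> sets (M \<Otimes>\<^sub>M M)"
  shows "measure (M \<Otimes>\<^sub>M M) C = (\<integral>\<omega>. prob {\<omega>' \<in> space M. (\<omega>, \<omega>') \<in> C} \<partial>M)"
proof -
  interpret MM: pair_prob_space M M ..
  have "(\<integral>\<omega>. prob {\<omega>' \<in> space M. (\<omega>, \<omega>') \<in> C} \<partial>M)
      = (\<integral>\<omega>. (\<integral>\<omega>'. indicator C (\<omega>, \<omega>') \<partial>M) \<partial>M)"
  proof (rule Bochner_Integration.integral_cong[OF refl])
    fix \<omega> assume "\<omega> \<in> space M"
    have "(\<integral>\<omega>'. indicator C (\<omega>, \<omega>') \<partial>M) = (\<integral>\<omega>'. indicator {\<omega>' \<in> space M. (\<omega>, \<omega>') \<in> C} \<omega>' \<partial>M)"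
      by (intro Bochner_Integration.integral_cong) (auto simp: indicator_def)
    also have "\<dots> = prob {\<omega>' \<in> space M. (\<omega>, \<omega>') \<in> C}"
      by (simp add: Int_absorb2)
    finally show "prob {\<omega>' \<in> space M. (\<omega>, \<omega>') \<in> C} = (\<integral>\<omega>'. indicator C (\<omega>, \<omega>') \<partial>M)" by simp
  qed
  also have "\<dots> = (\<integral>x. indicator C x \<partial>(M \<Otimes>\<^sub>M M))"
    using assms by (intro MM.integral_fst') (simp add: MM.emeasure_eq_measure less_top[symmetric])
  also have "\<dots> = measure (M \<Otimes>\<^sub>M M) C"
    using sets.sets_into_space[OF assms] by (simp add: Int_absorb2)
  finally show ?thesis by simp
qed

text \<open>\<open>A\<close> is pulled back along the restriction of the full past and future to
  \<open>J\<close> and \<open>K\<close>. The product of the two laws is the image of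
  \<open>M \<Otimes>\<^sub>M M\<close>, which gives the integral.\<close>

lemma decouple_at_zero:
  assumes J: "J \<subseteq> {..0}" and K: "K \<subseteq> {int r..}"
    and A: "A \<in> sets (PiM J (\<lambda>_. N) \<Otimes>\<^sub>M PiM K (\<lambda>_. N))"
  shows "\<bar>prob {\<omega> \<in> space M. (window J \<omega>, window K \<omega>) \<in> A}
           - (\<integral>\<omega>. prob {\<omega>' \<in> space M. (window J \<omega>, window K \<omega>') \<in> A} \<partial>M)\<bar> \<le> \<beta> r"
proof -
  let ?P = "PiM {..0::int} (\<lambda>_. N)" and ?F = "PiM {int r..} (\<lambda>_. N)"
  let ?f = "\<lambda>(x, y). (restrict x J, restrict y K)"
  define C where "C = ?f -` A \<inter> space (?P \<Otimes>\<^sub>M ?F)"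
  note measurable_restrict_subset[OF J, measurable] measurable_restrict_subset[OF K, measurable]
  have "?f \<in> measurable (?P \<Otimes>\<^sub>M ?F) (PiM J (\<lambda>_. N) \<Otimes>\<^sub>M PiM K (\<lambda>_. N))"
    by measurable
  then have C: "C \<in> sets (?P \<Otimes>\<^sub>M ?F)"
    unfolding C_def using A by (rule measurable_sets)
  have C_iff: "(window {..0} \<omega>, window {int r..} \<omega>') \<in> C \<longleftrightarrow> (window J \<omega>, window K \<omega>') \<in> A"
    if "\<omega> \<in> space M" "\<omega>' \<in> space M" for \<omega> \<omega>'
    using that measurable_space[OF measurable_window] J K
    by (auto simp: C_def space_pair_measure restrict_window)
  have 1: "measure (distr M (?P \<Otimes>\<^sub>M ?F) (\<lambda>\<omega>. (window {..0} \<omega>, window {int r..} \<omega>))) C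
      = prob {\<omega> \<in> space M. (window J \<omega>, window K \<omega>) \<in> A}"
    using C by (subst measure_distr) (auto intro!: arg_cong[where f = prob] simp: C_iff)
  have "distr M ?P (window {..0}) \<Otimes>\<^sub>M distr M ?F (window {int r..})
     = distr (M \<Otimes>\<^sub>M M) (?P \<Otimes>\<^sub>M ?F) (\<lambda>(x, y). (window {..0} x, window {int r..} y))"
    by (rule pair_measure_distr) (auto intro!: prob_space_imp_sigma_finite prob_space_distr)
  then have "measure (distr M ?P (window {..0}) \<Otimes>\<^sub>M distr M ?F (window {int r..})) C
    = measure (M \<Otimes>\<^sub>M M) ((\<lambda>(x, y). (window {..0} x, window {int r..} y)) -` C \<inter> space (M \<Otimes>\<^sub>M M))"
    using C by (simp add: measure_distr)
  also have "\<dots> = (\<integral>\<omega>. prob {\<omega>' \<in> space M. (window J \<omega>, window K \<omega>') \<in> A} \<partial>M)"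
    using C by (subst measure_pair_eq_integral)
      (auto intro!: Bochner_Integration.integral_cong arg_cong[where f = prob]
            simp: C_iff space_pair_measure)
  finally show ?thesis using beta_coeff_upper[OF C] 1 by simp
qed

lemma prob_window_shift:
  assumes "finite J" and C: "C \<in> sets (PiM J (\<lambda>_. N))"
  shows "prob {\<omega> \<in> space M. (\<lambda>j\<in>J. Z (j + k) \<omega>) \<in> C} = prob {\<omega> \<in> space M. window J \<omega> \<in> C}"
proof -
  have "measure (distr M (PiM J (\<lambda>_. N)) (\<lambda>\<omega>. \<lambda>j\<in>J. Z (j + k) \<omega>)) C
      = measure (distr M (PiM J (\<lambda>_. N)) (window J)) C"
    using stationary \<open>finite J\<close> unfolding stationary_process_def window_def by simp
  then show ?thesis using C
    by (subst (asm) (1 2) measure_distr) (auto simp: vimage_def Int_def conj_commute)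
qed

lemma measurable_prob_window:
  assumes A: "A \<in> sets (D \<Otimes>\<^sub>M PiM K (\<lambda>_. N))"
  shows "(\<lambda>x. prob {\<omega> \<in> space M. (x, window K \<omega>) \<in> A}) \<in> borel_measurable D"
proof (intro measurable_measure)
  have "(\<lambda>z. (fst z, window K (snd z))) \<in> measurable (D \<Otimes>\<^sub>M M) (D \<Otimes>\<^sub>M PiM K (\<lambda>_. N))"
    by measurable
  from measurable_sets[OF this A]
  show "{z \<in> space (D \<Otimes>\<^sub>M M). snd z \<in> {\<omega> \<in> space M. (fst z, window K \<omega>) \<in> A}} \<in> sets (D \<Otimes>\<^sub>M M)"
    by (rule back_subst[where P = "\<lambda>S. S \<in> _"]) (auto simp: space_pair_measure)
qed auto

text \<open>Stationarity moves the cut \<open>l\<close> to time 0. It is given for finite windows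
  only, so the joint probability is shifted over the union of both windows, and the product
  probability in each factor separately.\<close>

lemma decouple:
  assumes fin: "finite J" "finite K" and J: "J \<subseteq> {..l}" and K: "K \<subseteq> {l + int r..}"
    and A: "A \<in> sets (PiM J (\<lambda>_. N) \<Otimes>\<^sub>M PiM K (\<lambda>_. N))"
  shows "\<bar>prob {\<omega> \<in> space M. (window J \<omega>, window K \<omega>) \<in> A}
           - (\<integral>\<omega>. prob {\<omega>' \<in> space M. (window J \<omega>, window K \<omega>') \<in> A} \<partial>M)\<bar> \<le> \<beta> r"
proof -
  define J' where "J' = (\<lambda>i. i - l) ` J"
  define K' where "K' = (\<lambda>i. i - l) ` K"
  define A' where "A' = (\<lambda>(x, y). (\<lambda>i\<in>J. x (i - l), \<lambda>i\<in>K. y (i - l))) -` A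
    \<inter> space (PiM J' (\<lambda>_. N) \<Otimes>\<^sub>M PiM K' (\<lambda>_. N))"
  define U where "U = J' \<union> K'"
  define C where "C = (\<lambda>w. (\<lambda>i\<in>J. w (i - l), \<lambda>i\<in>K. w (i - l))) -` A \<inter> space (PiM U (\<lambda>_. N))"
  have in_J': "i - l \<in> J'" if "i \<in> J" for i using that by (auto simp: J'_def)
  have in_K': "i - l \<in> K'" if "i \<in> K" for i using that by (auto simp: K'_def)
  have A': "A' \<in> sets (PiM J' (\<lambda>_. N) \<Otimes>\<^sub>M PiM K' (\<lambda>_. N))"
    unfolding A'_def case_prod_beta using in_J' in_K'
    by (intro measurable_sets[OF _ A] measurable_Pair measurable_restrict
        measurable_compose[OF measurable_fst measurable_component_singleton]
        measurable_compose[OF measurable_snd measurable_component_singleton])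
  have C: "C \<in> sets (PiM U (\<lambda>_. N))"
    unfolding C_def using in_J' in_K'
    by (intro measurable_sets[OF _ A] measurable_Pair measurable_restrict measurable_component_singleton)
       (auto simp: U_def)
  have A'_iff: "(window J' \<omega>, window K' \<omega>') \<in> A'
      \<longleftrightarrow> (\<lambda>i\<in>J. Z (i - l) \<omega>, \<lambda>i\<in>K. Z (i - l) \<omega>') \<in> A"
    if "\<omega> \<in> space M" "\<omega>' \<in> space M" for \<omega> \<omega>'
    using that measurable_space[OF measurable_window] in_J' in_K'
    by (simp add: A'_def space_pair_measure window_apply cong: restrict_cong)
  have shift: "prob {\<omega> \<in> space M. (\<lambda>i\<in>I. Z (i - l) \<omega>) \<in> D} = prob {\<omega> \<in> space M. window I \<omega> \<in> D}"
    if "finite I" "D \<in> sets (PiM I (\<lambda>_. N))" for I D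
    using prob_window_shift[OF that, of "- l"] by simp
  have "finite U" using fin by (simp add: U_def J'_def K'_def)
  have "prob {\<omega> \<in> space M. (window J \<omega>, window K \<omega>) \<in> A}
      = prob {\<omega> \<in> space M. (\<lambda>j\<in>U. Z (j + l) \<omega>) \<in> C}"
  proof (intro arg_cong[where f = prob] Collect_cong conj_cong refl)
    fix \<omega> assume "\<omega> \<in> space M"
    then have "(\<lambda>j\<in>U. Z (j + l) \<omega>) \<in> space (PiM U (\<lambda>_. N))"
      using measurable_space[OF measurable_Z] by (auto simp: space_PiM)
    then show "(window J \<omega>, window K \<omega>) \<in> A \<longleftrightarrow> (\<lambda>j\<in>U. Z (j + l) \<omega>) \<in> C"
      using in_J' in_K' by (simp add: C_def U_def window_def cong: restrict_cong)
  qed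
  also have "\<dots> = prob {\<omega> \<in> space M. window U \<omega> \<in> C}"
    by (rule prob_window_shift) fact+
  also have "\<dots> = prob {\<omega> \<in> space M. (window J' \<omega>, window K' \<omega>) \<in> A'}"
  proof (intro arg_cong[where f = prob] Collect_cong conj_cong refl)
    fix \<omega> assume \<omega>: "\<omega> \<in> space M"
    then have "window U \<omega> \<in> space (PiM U (\<lambda>_. N))"
      using measurable_space[OF measurable_window] by auto
    then show "window U \<omega> \<in> C \<longleftrightarrow> (window J' \<omega>, window K' \<omega>) \<in> A'"
      using in_J' in_K' by (simp add: C_def A'_iff[OF \<omega> \<omega>] U_def window_apply cong: restrict_cong)
  qed
  finally have joint: "prob {\<omega> \<in> space M. (window J \<omega>, window K \<omega>) \<in> A}
      = prob {\<omega> \<in> space M. (window J' \<omega>, window K' \<omega>) \<in> A'}" .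
  \<comment> \<open>The section probability: its argument is shifted through the law of the first
    window, its event by \<open>shift\<close>.\<close>
  define G where "G x = prob {\<omega>' \<in> space M. (x, window K \<omega>') \<in> A}" for x
  have G: "G \<in> borel_measurable (PiM J (\<lambda>_. N))"
    unfolding G_def[abs_def] using A by (rule measurable_prob_window)
  have "distr M (PiM J (\<lambda>_. N)) (\<lambda>\<omega>. \<lambda>i\<in>J. Z (i - l) \<omega>) = distr M (PiM J (\<lambda>_. N)) (window J)"
    using stationary[unfolded stationary_process_def, THEN conjunct2, rule_format, OF fin(1), of "- l"]
    by (simp add: window_def[abs_def])
  then have "(\<integral>x. G x \<partial>distr M (PiM J (\<lambda>_. N)) (\<lambda>\<omega>. \<lambda>i\<in>J. Z (i - l) \<omega>))
      = (\<integral>x. G x \<partial>distr M (PiM J (\<lambda>_. N)) (window J))" by simp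
  then have "(\<integral>\<omega>. G (\<lambda>i\<in>J. Z (i - l) \<omega>) \<partial>M) = (\<integral>\<omega>. G (window J \<omega>) \<partial>M)"
    using G by (subst (asm) (1 2) integral_distr) auto
  moreover have "G x = prob {\<omega>' \<in> space M. (x, \<lambda>i\<in>K. Z (i - l) \<omega>') \<in> A}" for x
    using shift[OF fin(2) sets_Pair1[OF A, of x]] by (simp add: G_def)
  moreover have "prob {\<omega>' \<in> space M. (window J' \<omega>, window K' \<omega>') \<in> A'}
     = prob {\<omega>' \<in> space M. (\<lambda>i\<in>J. Z (i - l) \<omega>, \<lambda>i\<in>K. Z (i - l) \<omega>') \<in> A}" if "\<omega> \<in> space M" for \<omega>
    using that by (intro arg_cong[where f = prob] Collect_cong) (auto simp: A'_iff)
  ultimately have indep: "(\<integral>\<omega>. prob {\<omega>' \<in> space M. (window J' \<omega>, window K' \<omega>') \<in> A'} \<partial>M)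
      = (\<integral>\<omega>. G (window J \<omega>) \<partial>M)"
    by (simp cong: Bochner_Integration.integral_cong)
  have "J' \<subseteq> {..0}" "K' \<subseteq> {int r..}" using J K by (auto simp: J'_def K'_def)
  from decouple_at_zero[OF this A'] show ?thesis
    by (simp add: joint indep G_def)
qed

section \<open>One-point marginals and covariances of events\<close>

lemma prob_Z_in:
  assumes "E \<in> sets N"
  shows "prob {\<omega> \<in> space M. Z i \<omega> \<in> E} = prob {\<omega> \<in> space M. Z 1 \<omega> \<in> E}"
proof -
  have *: "{x \<in> space (PiM {1} (\<lambda>_. N)). x 1 \<in> E} \<in> sets (PiM {1::int} (\<lambda>_. N))"
    using assms by measurable
  have "(\<lambda>j\<in>{1}. Z (j + k) \<omega>) \<in> space (PiM {1::int} (\<lambda>_. N))" if "\<omega> \<in> space M" for k \<omega>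
    using that measurable_space[OF measurable_Z] by (auto simp: space_PiM)
  note this[of _ "i - 1"] this[of _ 0]
  then show ?thesis
    using prob_window_shift[OF _ *, of "i - 1"] by (simp add: window_def cong: conj_cong)
qed

text \<open>Decoupling applied to a rectangle: under the product law its probability factorises into
  the square of the stationary probability of \<open>E\<close>.\<close>

lemma covariance_indicator_le_beta:
  assumes E: "E \<in> sets N" and ij: "i + int r \<le> j"
  shows "\<bar>prob {\<omega> \<in> space M. Z i \<omega> \<in> E \<and> Z j \<omega> \<in> E} - (prob {\<omega> \<in> space M. Z 1 \<omega> \<in> E})\<^sup>2\<bar> \<le> \<beta> r"
proof -
  let ?P1 = "PiM {i} (\<lambda>_. N)" and ?P2 = "PiM {j} (\<lambda>_. N)"
  define A where "A = {z \<in> space (?P1 \<Otimes>\<^sub>M ?P2). fst z i \<in> E \<and> snd z j \<in> E}"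
  have A: "A \<in> sets (?P1 \<Otimes>\<^sub>M ?P2)"
    unfolding A_def using E by measurable
  have A_iff: "(window {i} \<omega>, window {j} \<omega>') \<in> A \<longleftrightarrow> Z i \<omega> \<in> E \<and> Z j \<omega>' \<in> E"
    if "\<omega> \<in> space M" "\<omega>' \<in> space M" for \<omega> \<omega>'
    using that measurable_space[OF measurable_window]
    by (auto simp: A_def space_pair_measure window_apply)
  have "(\<integral>\<omega>. prob {\<omega>' \<in> space M. (window {i} \<omega>, window {j} \<omega>') \<in> A} \<partial>M)
      = (\<integral>\<omega>. indicator {\<omega> \<in> space M. Z i \<omega> \<in> E} \<omega> * prob {\<omega>' \<in> space M. Z 1 \<omega>' \<in> E} \<partial>M)"
    using prob_Z_in[OF E, of j]
    by (intro Bochner_Integration.integral_cong refl)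
       (auto simp: A_iff indicator_def cong: conj_cong)
  also have "\<dots> = (prob {\<omega> \<in> space M. Z 1 \<omega> \<in> E})\<^sup>2"
    using prob_Z_in[OF E, of i] by (simp add: power2_eq_square Int_absorb2)
  finally show ?thesis
    using decouple[of "{i}" "{j}" i r A] A ij by (simp add: A_iff cong: conj_cong)
qed

section \<open>Concentration by blocking\<close>

lemma expectation_indicator_Z:
  assumes [measurable]: "E \<in> sets N"
  shows "(\<integral>\<omega>. indicat_real E (Z t \<omega>) \<partial>M) = prob {\<omega> \<in> space M. Z 1 \<omega> \<in> E}"
proof -
  have "(\<integral>\<omega>. indicat_real E (Z t \<omega>) \<partial>M) = (\<integral>\<omega>. indicator {\<omega> \<in> space M. Z t \<omega> \<in> E} \<omega> \<partial>M)"
    by (intro Bochner_Integration.integral_cong) (auto simp: indicator_def)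
  then show ?thesis using prob_Z_in[of E t] by (simp add: Int_absorb2)
qed

text \<open>Expanding the square gives all covariances within the block: at most 1/4 on the diagonal
  and at most \<open>\<beta> j\<close> at lag \<open>j\<close>. Their Toeplitz sum is the variance
  proxy.\<close>

lemma block_second_moment:
  assumes [measurable]: "E \<in> sets N" and "a > 0"
  defines "p \<equiv> prob {\<omega> \<in> space M. Z 1 \<omega> \<in> E}"
  shows "(\<integral>\<omega>. (\<Sum>i<a. indicator E (Z (k + int i) \<omega>) - p)\<^sup>2 \<partial>M) \<le> real a * (sigma_tilde \<beta> a)\<^sup>2"
proof -
  define X where "X i \<omega> = indicator E (Z (k + int i) \<omega>) - p" for i \<omega>
  have p: "0 \<le> p" "p \<le> 1" by (simp_all add: p_def)
  have [measurable]: "X i \<in> borel_measurable M" for i unfolding X_def[abs_def] by measurable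
  have X_bound: "\<bar>X i \<omega>\<bar> \<le> 1" for i \<omega> using p by (auto simp: X_def indicator_def)
  have XX_int: "integrable M (\<lambda>\<omega>. X i \<omega> * X j \<omega>)" for i j
    using X_bound by (intro integrable_const_bound[where B = 1]) (auto simp: abs_mult intro!: mult_le_one)
  have ind: "integrable M (\<lambda>\<omega>. indicator E (Z t \<omega>) :: real)" for t
    by (intro integrable_const_bound[where B = 1]) auto
  have ind2: "integrable M (\<lambda>\<omega>. indicator E (Z t \<omega>) * indicator E (Z t' \<omega>) :: real)" for t t'
    by (intro integrable_const_bound[where B = 1]) (auto simp: indicator_def)
  have mean: "(\<integral>\<omega>. indicat_real E (Z t \<omega>) \<partial>M) = p" for t
    unfolding p_def by (rule expectation_indicator_Z) fact
  have joint: "(\<integral>\<omega>. indicat_real E (Z t \<omega>) * indicat_real E (Z t' \<omega>) \<partial>M)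
      = prob {\<omega> \<in> space M. Z t \<omega> \<in> E \<and> Z t' \<omega> \<in> E}" for t t'
  proof -
    have "(\<integral>\<omega>. indicat_real E (Z t \<omega>) * indicat_real E (Z t' \<omega>) \<partial>M)
        = (\<integral>\<omega>. indicator {\<omega> \<in> space M. Z t \<omega> \<in> E \<and> Z t' \<omega> \<in> E} \<omega> \<partial>M)"
      by (intro Bochner_Integration.integral_cong) (auto simp: indicator_def)
    then show ?thesis by (simp add: Int_absorb2)
  qed
  have cov: "(\<integral>\<omega>. X i \<omega> * X j \<omega> \<partial>M)
      = prob {\<omega> \<in> space M. Z (k + int i) \<omega> \<in> E \<and> Z (k + int j) \<omega> \<in> E} - p\<^sup>2" for i j
  proof -
    have "(\<integral>\<omega>. X i \<omega> * X j \<omega> \<partial>M) = (\<integral>\<omega>. indicator E (Z (k + int i) \<omega>) * indicator E (Z (k + int j) \<omega>)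
        - p * indicator E (Z (k + int i) \<omega>) - p * indicator E (Z (k + int j) \<omega>) + p\<^sup>2 \<partial>M)"
      by (intro Bochner_Integration.integral_cong) (auto simp: X_def algebra_simps power2_eq_square)
    also have "\<dots> = prob {\<omega> \<in> space M. Z (k + int i) \<omega> \<in> E \<and> Z (k + int j) \<omega> \<in> E} - p * p - p * p + p\<^sup>2"
      using ind ind2 by (simp add: mean joint prob_space)
    finally show ?thesis by (simp add: power2_eq_square)
  qed
  have le: "(\<integral>\<omega>. X i \<omega> * X j \<omega> \<partial>M)
      \<le> (if i = j then 1/4 else if i < j then \<beta> (j - i) else \<beta> (i - j))" for i j
  proof -
    have "p - p\<^sup>2 \<le> 1/4" using zero_le_power2[of "p - 1/2"]
      by (simp add: power2_eq_square algebra_simps)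
    \<comment> \<open>On the diagonal the joint probability is \<open>p\<close>, which leaves the
      Bernoulli variance; off it, the covariance bound is taken with the earlier time first.\<close>
    then show ?thesis
      using covariance_indicator_le_beta[of E "k + int i" "j - i" "k + int j"]
        covariance_indicator_le_beta[of E "k + int j" "i - j" "k + int i"]
        prob_Z_in[of E "k + int i"]
      unfolding cov by (cases i j rule: linorder_cases) (auto simp: p_def conj_commute)
  qed
  have "(\<integral>\<omega>. (\<Sum>i<a. X i \<omega>)\<^sup>2 \<partial>M) = (\<Sum>i<a. \<Sum>j<a. \<integral>\<omega>. X i \<omega> * X j \<omega> \<partial>M)"
    using XX_int by (simp add: power2_eq_square sum_product)
  also have "\<dots> \<le> (\<Sum>i<a. \<Sum>j<a. if i = j then 1/4 else if i < j then \<beta> (j - i) else \<beta> (i - j))"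
    by (intro sum_mono le)
  also have "\<dots> = real a * (sigma_tilde \<beta> a)\<^sup>2"
  proof -
    have "0 \<le> (\<Sum>j=1..<a. real (a - j) * \<beta> j)"
      by (intro sum_nonneg mult_nonneg_nonneg beta_nonneg) auto
    then have "(sigma_tilde \<beta> a)\<^sup>2 = 1/4 + (2 / real a) * (\<Sum>j=1..<a. real (a - j) * \<beta> j)"
      unfolding sigma_tilde_def by (intro real_sqrt_pow2 add_nonneg_nonneg mult_nonneg_nonneg) auto
    then show ?thesis unfolding sum_toeplitz using \<open>a > 0\<close> by (simp add: field_simps)
  qed
  finally show ?thesis by (simp add: X_def)
qed

section \<open>Exponential tails for sums over separated blocks\<close>

text \<open>There are \<open>m + 1\<close> blocks, hence \<open>m\<close> decouplings. The induction
  detaches the first block: given its sum \<open>U\<close>, the remaining ones must reach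
  \<open>t - U\<close>, and averaging the induction hypothesis over \<open>U\<close> contributes one
  more factor \<Gamma>. Therefore \<open>k\<close> and \<open>t\<close> stay arbitrary.\<close>

lemma spaced_blocks_tail:
  fixes f :: "'z \<Rightarrow> real"
  assumes f [measurable]: "f \<in> borel_measurable N" and bound: "\<And>z. \<bar>f z\<bar> \<le> 1"
    and "0 < \<theta>"
    and mgf: "\<And>k. (\<integral>\<omega>. exp (\<theta> * (\<Sum>i<a. f (Z (k + int i) \<omega>))) \<partial>M) \<le> \<Gamma>"
  shows "prob {\<omega> \<in> space M. (\<Sum>j\<le>m. \<Sum>i<a. f (Z (k + int (2 * a * j + i)) \<omega>)) \<ge> t}
    \<le> real m * \<beta> a + exp (- \<theta> * t) * \<Gamma> ^ Suc m"
proof (induction m arbitrary: k t)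
  have U_bound: "\<bar>\<Sum>i<a. f (Z (k + int i) \<omega>)\<bar> \<le> real a" for k \<omega>
    using sum_norm_bound[of "{..<a}" "\<lambda>i. f (Z (k + int i) \<omega>)" 1] bound by simp
  {
    case 0
    have "prob {\<omega> \<in> space M. (\<Sum>i<a. f (Z (k + int i) \<omega>)) \<ge> t}
        \<le> exp (- \<theta> * t) * (\<integral>\<omega>. exp (\<theta> * (\<Sum>i<a. f (Z (k + int i) \<omega>))) \<partial>M)"
      by (rule markov_exp[OF _ U_bound \<open>0 < \<theta>\<close>]) measurable
    also have "\<dots> \<le> exp (- \<theta> * t) * \<Gamma>"
      by (intro mult_left_mono mgf) simp
    finally show ?case by simp
  next
    case (Suc m)
    \<comment> \<open>The first block \<open>J\<close> and the span \<open>K\<close> of the others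
      are separated by a gap of length \<open>a\<close>.\<close>
    define J where "J = {k..<k + int a}"
    define K where "K = {k + int (2 * a)..<k + int (2 * a * (m + 2))}"
    let ?PJ = "PiM J (\<lambda>_. N)" and ?PK = "PiM K (\<lambda>_. N)"
    define U where "U \<omega> = (\<Sum>i<a. f (Z (k + int i) \<omega>))" for \<omega>
    define S where "S \<omega> = (\<Sum>j\<le>m. \<Sum>i<a. f (Z (k + int (2 * a) + int (2 * a * j + i)) \<omega>))" for \<omega>
    define A where "A = {z \<in> space (?PJ \<Otimes>\<^sub>M ?PK).
      (\<Sum>i<a. f (fst z (k + int i))) + (\<Sum>j\<le>m. \<Sum>i<a. f (snd z (k + int (2 * a) + int (2 * a * j + i)))) \<ge> t}"
    have in_J: "k + int i \<in> J" if "i < a" for i using that by (simp add: J_def)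
    have in_K: "k + int (2 * a) + int (2 * a * j + i) \<in> K" if "i < a" "j \<le> m" for i j
    proof -
      have "2 * a + (2 * a * j + i) < 2 * a * (j + 2)" using that by (simp add: algebra_simps)
      also have "\<dots> \<le> 2 * a * (m + 2)" using that by (intro mult_left_mono) auto
      finally have "int (2 * a + (2 * a * j + i)) < int (2 * a * (m + 2))" by (simp only: of_nat_less_iff)
      then show ?thesis by (simp add: K_def)
    qed
    have [measurable]: "(\<lambda>z. f (fst z (k + int i))) \<in> borel_measurable (?PJ \<Otimes>\<^sub>M ?PK)" if "i < a" for i
      using in_J[OF that] by measurable
    have [measurable]: "(\<lambda>z. f (snd z (k + int (2 * a) + int (2 * a * j + i)))) \<in> borel_measurable (?PJ \<Otimes>\<^sub>M ?PK)"
      if "i < a" "j \<le> m" for i j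
      using in_K[OF that] by measurable
    have "(\<lambda>z. (\<Sum>i<a. f (fst z (k + int i))) + (\<Sum>j\<le>m. \<Sum>i<a. f (snd z (k + int (2 * a) + int (2 * a * j + i)))))
        \<in> borel_measurable (?PJ \<Otimes>\<^sub>M ?PK)"
      by (intro borel_measurable_add borel_measurable_sum) (simp_all del: of_nat_add of_nat_mult)
    then have A: "A \<in> sets (?PJ \<Otimes>\<^sub>M ?PK)"
      unfolding A_def by measurable
    have A_iff: "(window J \<omega>, window K \<omega>') \<in> A \<longleftrightarrow> U \<omega> + S \<omega>' \<ge> t" if "\<omega> \<in> space M" "\<omega>' \<in> space M" for \<omega> \<omega>'
      using that measurable_space[OF measurable_window] in_J in_K
      by (simp add: A_def space_pair_measure window_apply U_def S_def del: of_nat_add of_nat_mult)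
    have [measurable]: "U \<in> borel_measurable M" unfolding U_def[abs_def] by measurable
    have expU: "integrable M (\<lambda>\<omega>. exp (\<theta> * U \<omega>))"
      using U_bound[of k] \<open>0 < \<theta>\<close>
      by (intro integrable_const_bound[where B = "exp (\<theta> * real a)"])
         (auto simp: U_def intro!: mult_left_mono dest: abs_le_D1)
    have "0 \<le> \<Gamma>" by (rule order_trans[OF _ mgf[of k]]) simp
    have "(\<Sum>j\<le>Suc m. \<Sum>i<a. f (Z (k + int (2 * a * j + i)) \<omega>)) = U \<omega> + S \<omega>" for \<omega>
      by (subst sum.atMost_Suc_shift) (simp add: U_def S_def algebra_simps)
    then have "prob {\<omega> \<in> space M. (\<Sum>j\<le>Suc m. \<Sum>i<a. f (Z (k + int (2 * a * j + i)) \<omega>)) \<ge> t}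
        = prob {\<omega> \<in> space M. (window J \<omega>, window K \<omega>) \<in> A}"
      by (intro arg_cong[where f = prob] Collect_cong) (auto simp: A_iff)
    also have "\<dots> \<le> \<beta> a + (\<integral>\<omega>. prob {\<omega>' \<in> space M. (window J \<omega>, window K \<omega>') \<in> A} \<partial>M)"
    proof -
      \<comment> \<open>The cut is at \<open>k + int a\<close>, and \<open>K\<close> starts exactly
        \<open>a\<close> later.\<close>
      have "finite J" "finite K" "J \<subseteq> {..k + int a}" "K \<subseteq> {k + int a + int a..}"
        by (auto simp: J_def K_def)
      from decouple[OF this A] show ?thesis by linarith
    qed
    also have "(\<integral>\<omega>. prob {\<omega>' \<in> space M. (window J \<omega>, window K \<omega>') \<in> A} \<partial>M)
        \<le> (\<integral>\<omega>. real m * \<beta> a + exp (- \<theta> * t) * \<Gamma> ^ Suc m * exp (\<theta> * U \<omega>) \<partial>M)"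
    proof (rule integral_mono)
      fix \<omega> assume \<omega>: "\<omega> \<in> space M"
      have "prob {\<omega>' \<in> space M. (window J \<omega>, window K \<omega>') \<in> A} = prob {\<omega>' \<in> space M. S \<omega>' \<ge> t - U \<omega>}"
        using \<omega> by (intro arg_cong[where f = prob] Collect_cong) (auto simp: A_iff)
      \<comment> \<open>The induction hypothesis at the threshold \<open>t - U \<omega>\<close>, a
        constant once \<omega> is fixed, and at the start \<open>k + int (2 * a)\<close>.\<close>
      also have "\<dots> \<le> real m * \<beta> a + exp (- \<theta> * (t - U \<omega>)) * \<Gamma> ^ Suc m"
        unfolding S_def by (rule Suc.IH)
      also have "exp (- \<theta> * (t - U \<omega>)) = exp (- \<theta> * t) * exp (\<theta> * U \<omega>)"
        by (simp add: algebra_simps flip: exp_add)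
      finally show "prob {\<omega>' \<in> space M. (window J \<omega>, window K \<omega>') \<in> A}
          \<le> real m * \<beta> a + exp (- \<theta> * t) * \<Gamma> ^ Suc m * exp (\<theta> * U \<omega>)"
        by (simp add: ac_simps)
    next
      have "(\<lambda>\<omega>. prob {\<omega>' \<in> space M. (window J \<omega>, window K \<omega>') \<in> A}) \<in> borel_measurable M"
        by (rule measurable_compose[OF measurable_window measurable_prob_window[OF A]])
      then show "integrable M (\<lambda>\<omega>. prob {\<omega>' \<in> space M. (window J \<omega>, window K \<omega>') \<in> A})"
        by (intro integrable_const_bound[where B = 1]) auto
    qed (use expU in auto)
    also have "\<dots> = real m * \<beta> a + exp (- \<theta> * t) * \<Gamma> ^ Suc m * (\<integral>\<omega>. exp (\<theta> * U \<omega>) \<partial>M)"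
      using expU by (simp add: prob_space)
    also have "\<dots> \<le> real m * \<beta> a + exp (- \<theta> * t) * \<Gamma> ^ Suc m * \<Gamma>"
      using mgf[of k] \<open>0 \<le> \<Gamma>\<close> by (intro add_left_mono mult_left_mono) (auto simp: U_def)
    finally show ?case by (simp add: algebra_simps)
  }
qed

lemma sigma_tilde_pos: "0 < sigma_tilde \<beta> a"
  unfolding sigma_tilde_def
  by (intro real_sqrt_gt_zero add_pos_nonneg mult_nonneg_nonneg sum_nonneg beta_nonneg) auto

text \<open>The sum over \<open>m\<close> blocks is treated as sub-gamma with parameters
  \<open>m * v\<close> and \<open>a / 3\<close>. The chosen \<theta> makes the Chernoff exponent at
  the stated threshold equal to \<open>- L\<close>; the remaining cost is that of
  \<open>m - 1\<close> decouplings.\<close>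

lemma bernstein_spaced_blocks:
  assumes E [measurable]: "E \<in> sets N" and "a > 0" "m > 0" "L > 0"
  defines "p \<equiv> prob {\<omega> \<in> space M. Z 1 \<omega> \<in> E}"
  shows "prob {\<omega> \<in> space M. (\<Sum>j<m. \<Sum>i<a. indicator E (Z (k + int (2 * a * j + i)) \<omega>) - p)
            \<ge> sigma_tilde \<beta> a * sqrt (2 * real m * real a * L) + real a * L / 3}
    \<le> (real m - 1) * \<beta> a + exp (- L)"
proof -
  define f where "f z = indicator E z - p" for z
  define v where "v = real a * (sigma_tilde \<beta> a)\<^sup>2"
  \<comment> \<open>A block sum is bounded by \<open>a\<close>, so the Bernstein denominator
    \<open>1 - \<theta> * a / 3\<close> is \<open>1 - \<theta> * c\<close>.\<close>
  define c where "c = real a / 3"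
  have p: "0 \<le> p" "p \<le> 1" by (simp_all add: p_def)
  have f_meas [measurable]: "f \<in> borel_measurable N" unfolding f_def[abs_def] by measurable
  have f_bound: "\<bar>f z\<bar> \<le> 1" for z using p by (auto simp: f_def indicator_def)
  have vc: "0 < real m * v" "0 < c"
    using \<open>a > 0\<close> \<open>m > 0\<close> sigma_tilde_pos[of a] by (auto simp: v_def c_def)
  define \<theta> where "\<theta> = sqrt (2 * L / (real m * v)) / (1 + c * sqrt (2 * L / (real m * v)))"
  note \<theta> = sub_gamma_exponent[OF vc \<open>L > 0\<close>, folded \<theta>_def]
  have mgf: "(\<integral>\<omega>. exp (\<theta> * (\<Sum>i<a. f (Z (k + int i) \<omega>))) \<partial>M) \<le> exp (\<theta>\<^sup>2 * v / (2 * (1 - \<theta> * real a / 3)))" for k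
  proof (rule bernstein_mgf)
    show "\<bar>\<Sum>i<a. f (Z (k + int i) \<omega>)\<bar> \<le> real a" for \<omega>
      using sum_norm_bound[of "{..<a}" "\<lambda>i. f (Z (k + int i) \<omega>)" 1] f_bound by simp
    show "(\<integral>\<omega>. (\<Sum>i<a. f (Z (k + int i) \<omega>)) \<partial>M) = 0"
    proof -
      have "(\<integral>\<omega>. indicat_real E (Z t \<omega>) \<partial>M) = p" for t
        unfolding p_def by (rule expectation_indicator_Z[OF E])
      moreover have "integrable M (\<lambda>\<omega>. indicat_real E (Z t \<omega>))" for t
        by (intro integrable_const_bound[where B = 1]) auto
      ultimately show ?thesis by (simp add: f_def prob_space)
    qed
    show "(\<integral>\<omega>. (\<Sum>i<a. f (Z (k + int i) \<omega>))\<^sup>2 \<partial>M) \<le> v"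
      using block_second_moment[OF E \<open>a > 0\<close>, of k] by (simp add: f_def v_def p_def)
  qed (use \<theta> in \<open>auto simp: c_def\<close>)
  have t: "sigma_tilde \<beta> a * sqrt (2 * real m * real a * L) + real a * L / 3
      = sqrt (2 * (real m * v) * L) + c * L"
    using sigma_tilde_pos[of a] by (simp add: v_def c_def real_sqrt_mult)
  obtain m' where m': "m = Suc m'" using \<open>m > 0\<close> by (cases m) auto
  have "prob {\<omega> \<in> space M. (\<Sum>j<m. \<Sum>i<a. f (Z (k + int (2 * a * j + i)) \<omega>))
            \<ge> sqrt (2 * (real m * v) * L) + c * L}
    \<le> real m' * \<beta> a + exp (- \<theta> * (sqrt (2 * (real m * v) * L) + c * L))
        * exp (\<theta>\<^sup>2 * v / (2 * (1 - \<theta> * real a / 3))) ^ m"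
    using spaced_blocks_tail[OF f_meas f_bound \<theta>(1) mgf, where m = m' and k = k] by (simp only: m' lessThan_Suc_atMost)
  also have "exp (- \<theta> * (sqrt (2 * (real m * v) * L) + c * L)) * exp (\<theta>\<^sup>2 * v / (2 * (1 - \<theta> * real a / 3))) ^ m
     = exp (- \<theta> * (sqrt (2 * (real m * v) * L) + c * L) + \<theta>\<^sup>2 * (real m * v) / (2 * (1 - \<theta> * c)))"
    by (simp add: mult_exp_exp c_def ac_simps flip: exp_of_nat_mult)
  also have "\<dots> = exp (- L)" unfolding \<theta>(3) ..
  finally show ?thesis unfolding t f_def by (simp add: m')
qed

text \<open>If the whole sum reaches \<open>2 * t\<close>, one of the two alternating families
  reaches \<open>t\<close>; the union bound gives the factor 2 in the probability.\<close>

lemma bernstein_consecutive: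
  assumes E [measurable]: "E \<in> sets N" and "a > 0" "m > 0" "L > 0"
  defines "p \<equiv> prob {\<omega> \<in> space M. Z 1 \<omega> \<in> E}"
  shows "prob {\<omega> \<in> space M. (\<Sum>i<2 * m * a. indicator E (Z (k + int i) \<omega>) - p)
            \<ge> 2 * (sigma_tilde \<beta> a * sqrt (2 * real m * real a * L) + real a * L / 3)}
    \<le> 2 * ((real m - 1) * \<beta> a + exp (- L))"
proof -
  define t where "t = sigma_tilde \<beta> a * sqrt (2 * real m * real a * L) + real a * L / 3"
  define S where "S k = {\<omega> \<in> space M. (\<Sum>j<m. \<Sum>i<a. indicator E (Z (k + int (2 * a * j + i)) \<omega>) - p) \<ge> t}" for k
  have [measurable]: "S k \<in> events" for k unfolding S_def by measurable
  have S: "prob (S k) \<le> (real m - 1) * \<beta> a + exp (- L)" for k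
    unfolding S_def t_def p_def by (rule bernstein_spaced_blocks) fact+
  have "prob {\<omega> \<in> space M. (\<Sum>i<2 * m * a. indicator E (Z (k + int i) \<omega>) - p) \<ge> 2 * t}
      \<le> prob (S k \<union> S (k + int a))"
  proof (intro finite_measure_mono subsetI)
    fix \<omega> assume \<omega>: "\<omega> \<in> {\<omega> \<in> space M. (\<Sum>i<2 * m * a. indicator E (Z (k + int i) \<omega>) - p) \<ge> 2 * t}"
    have "(\<Sum>i<2 * m * a. indicator E (Z (k + int i) \<omega>) - p)
       = (\<Sum>j<m. \<Sum>i<a. indicator E (Z (k + int (2 * a * j + i)) \<omega>) - p)
       + (\<Sum>j<m. \<Sum>i<a. indicator E (Z (k + int a + int (2 * a * j + i)) \<omega>) - p)"
      unfolding sum_alternating_blocks by (simp add: algebra_simps)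
    with \<omega> show "\<omega> \<in> S k \<union> S (k + int a)" by (auto simp: S_def)
  qed auto
  also have "\<dots> \<le> prob (S k) + prob (S (k + int a))" by (intro measure_Un_le) auto
  also have "\<dots> \<le> 2 * ((real m - 1) * \<beta> a + exp (- L))" using S[of k] S[of "k + int a"] by simp
  finally show ?thesis by (simp add: t_def)
qed

section \<open>Frequencies of sets depending on the training data\<close>

text \<open>Replacing the sample by an independent copy costs \<open>\<beta> r\<close>. With the
  window over \<open>J\<close> frozen, the section of \<open>B\<close> is a fixed event, almost
  surely of probability at most \<open>c\<close>, to which the bound for consecutive times
  applies.\<close>

lemma conditional_deviation:
  assumes J: "finite J" "J \<subseteq> {..l}" and k: "l + int r \<le> k"
    and B [measurable]: "B \<in> sets (PiM J (\<lambda>_. N) \<Otimes>\<^sub>M N)"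
    and "a > 0" "m > 0" "L > 0"
    and cond: "AE \<omega> in M. prob {\<omega>' \<in> space M. (window J \<omega>, Z 1 \<omega>') \<in> B} \<le> c"
  shows "prob {\<omega> \<in> space M. (\<Sum>i<2 * m * a. indicator B (window J \<omega>, Z (k + int i) \<omega>))
            \<ge> real (2 * m * a) * c + 2 * (sigma_tilde \<beta> a * sqrt (2 * real m * real a * L) + real a * L / 3)}
    \<le> \<beta> r + 2 * ((real m - 1) * \<beta> a + exp (- L))"
proof -
  define t where "t = 2 * (sigma_tilde \<beta> a * sqrt (2 * real m * real a * L) + real a * L / 3)"
  define K where "K = {k..<k + int (2 * m * a)}"
  let ?PJ = "PiM J (\<lambda>_. N)" and ?PK = "PiM K (\<lambda>_. N)"
  define A where "A = {z \<in> space (?PJ \<Otimes>\<^sub>M ?PK).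
    (\<Sum>i<2 * m * a. indicator B (fst z, snd z (k + int i))) \<ge> real (2 * m * a) * c + t}"
  have in_K: "k + int i \<in> K" if "i < 2 * m * a" for i using that by (simp add: K_def del: of_nat_mult)
  have "(\<lambda>z. indicat_real B (fst z, snd z (k + int i))) \<in> borel_measurable (?PJ \<Otimes>\<^sub>M ?PK)" if "i < 2 * m * a" for i
    using in_K[OF that] by measurable
  then have [measurable]: "(\<lambda>z. \<Sum>i<2 * m * a. indicat_real B (fst z, snd z (k + int i))) \<in> borel_measurable (?PJ \<Otimes>\<^sub>M ?PK)"
    by (intro borel_measurable_sum) auto
  have A: "A \<in> sets (?PJ \<Otimes>\<^sub>M ?PK)" unfolding A_def by measurable
  have A_iff: "(window J \<omega>, window K \<omega>') \<in> A
      \<longleftrightarrow> (\<Sum>i<2 * m * a. indicator B (window J \<omega>, Z (k + int i) \<omega>')) \<ge> real (2 * m * a) * c + t"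
    if "\<omega> \<in> space M" "\<omega>' \<in> space M" for \<omega> \<omega>'
    using that measurable_space[OF measurable_window] in_K
    by (simp add: A_def space_pair_measure window_apply)
  have "prob {\<omega> \<in> space M. (\<Sum>i<2 * m * a. indicator B (window J \<omega>, Z (k + int i) \<omega>)) \<ge> real (2 * m * a) * c + t}
      = prob {\<omega> \<in> space M. (window J \<omega>, window K \<omega>) \<in> A}"
    by (intro arg_cong[where f = prob] Collect_cong) (auto simp: A_iff)
  also have "\<dots> \<le> \<beta> r + (\<integral>\<omega>. prob {\<omega>' \<in> space M. (window J \<omega>, window K \<omega>') \<in> A} \<partial>M)"
  proof -
    have "finite K" "K \<subseteq> {l + int r..}" using k by (auto simp: K_def)
    from decouple[OF J(1) this(1) J(2) this(2) A] show ?thesis by linarith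
  qed
  also have "(\<integral>\<omega>. prob {\<omega>' \<in> space M. (window J \<omega>, window K \<omega>') \<in> A} \<partial>M)
      \<le> (\<integral>\<omega>. 2 * ((real m - 1) * \<beta> a + exp (- L)) \<partial>M)"
  proof (rule integral_mono_AE)
    have "(\<lambda>\<omega>. prob {\<omega>' \<in> space M. (window J \<omega>, window K \<omega>') \<in> A}) \<in> borel_measurable M"
      by (rule measurable_compose[OF measurable_window measurable_prob_window[OF A]])
    then show "integrable M (\<lambda>\<omega>. prob {\<omega>' \<in> space M. (window J \<omega>, window K \<omega>') \<in> A})"
      by (intro integrable_const_bound[where B = 1]) auto
    show "AE \<omega> in M. prob {\<omega>' \<in> space M. (window J \<omega>, window K \<omega>') \<in> A}
        \<le> 2 * ((real m - 1) * \<beta> a + exp (- L))"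
      using cond AE_space
    proof eventually_elim
      case (elim \<omega>)
      define E where "E = Pair (window J \<omega>) -` B"
      have E [measurable]: "E \<in> sets N" unfolding E_def by (rule sets_Pair1[OF B])
      define p where "p = prob {\<omega>' \<in> space M. Z 1 \<omega>' \<in> E}"
      have "p \<le> c" using elim by (simp add: p_def E_def)
      then have "real (2 * m * a) * p \<le> real (2 * m * a) * c" by (intro mult_left_mono) auto
      \<comment> \<open>Centring at \<open>p\<close> instead of the larger \<open>c\<close> enlarges
        the event.\<close>
      then have "prob {\<omega>' \<in> space M. (window J \<omega>, window K \<omega>') \<in> A}
          \<le> prob {\<omega>' \<in> space M. (\<Sum>i<2 * m * a. indicator E (Z (k + int i) \<omega>') - p) \<ge> t}"
        using elim
        by (intro finite_measure_mono) (auto simp: A_iff E_def indicator_vimage[symmetric] sum_subtractf indicator_def)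
      also have "\<dots> \<le> 2 * ((real m - 1) * \<beta> a + exp (- L))"
        unfolding p_def t_def by (rule bernstein_consecutive) fact+
      finally show ?case .
    qed
  qed simp
  finally show ?thesis by (simp add: t_def prob_space)
qed

text \<open>The interface between concentration and coverage. Upper deviations for all sets suffice,
  since complements give the lower ones. As \<omega>' is a fresh copy, the hypothesis on
  \<open>B\<close> is a conditional bound under the product law. \<open>0 \<le> \<epsilon>\<close>
  lets the coverage proofs keep their shifted levels in the unit interval.\<close>

definition concentrates :: "int set \<Rightarrow> int set \<Rightarrow> real \<Rightarrow> real \<Rightarrow> bool" where
  "concentrates J I \<epsilon> \<delta> \<longleftrightarrow> 0 \<le> \<epsilon> \<and> (\<forall>B\<in>sets (PiM J (\<lambda>_. N) \<Otimes>\<^sub>M N). \<forall>c\<ge>0.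
     (AE \<omega> in M. prob {\<omega>' \<in> space M. (window J \<omega>, Z 1 \<omega>') \<in> B} \<le> c) \<longrightarrow>
     prob {\<omega> \<in> space M. (1 / real (card I)) * (\<Sum>i\<in>I. indicator B (window J \<omega>, Z i \<omega>)) \<ge> c + \<epsilon>} \<le> \<delta>)"

lemma concentrates_upper:
  assumes "concentrates J I \<epsilon> \<delta>" "B \<in> sets (PiM J (\<lambda>_. N) \<Otimes>\<^sub>M N)" "0 \<le> c"
    and "AE \<omega> in M. prob {\<omega>' \<in> space M. (window J \<omega>, Z 1 \<omega>') \<in> B} \<le> c"
  shows "prob {\<omega> \<in> space M. (1 / real (card I)) * (\<Sum>i\<in>I. indicator B (window J \<omega>, Z i \<omega>)) \<ge> c + \<epsilon>} \<le> \<delta>"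
  using assms unfolding concentrates_def by blast

text \<open>The complement of \<open>B\<close>, with level \<open>1 - c\<close>, turns a lower
  deviation into an upper one.\<close>

lemma concentrates_lower:
  assumes con: "concentrates J I \<epsilon> \<delta>" and I: "finite I" "I \<noteq> {}"
    and B [measurable]: "B \<in> sets (PiM J (\<lambda>_. N) \<Otimes>\<^sub>M N)" and "c \<le> 1"
    and cond: "AE \<omega> in M. c \<le> prob {\<omega>' \<in> space M. (window J \<omega>, Z 1 \<omega>') \<in> B}"
  shows "prob {\<omega> \<in> space M. (1 / real (card I)) * (\<Sum>i\<in>I. indicator B (window J \<omega>, Z i \<omega>)) \<le> c - \<epsilon>} \<le> \<delta>"
proof -
  define B' where "B' = space (PiM J (\<lambda>_. N) \<Otimes>\<^sub>M N) - B"
  have B' [measurable]: "B' \<in> sets (PiM J (\<lambda>_. N) \<Otimes>\<^sub>M N)" unfolding B'_def by measurable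
  have in_space: "(window J \<omega>, Z i \<omega>') \<in> space (PiM J (\<lambda>_. N) \<Otimes>\<^sub>M N)" if "\<omega> \<in> space M" "\<omega>' \<in> space M" for \<omega> \<omega>' i
    using that measurable_space[OF measurable_window] measurable_space[OF measurable_Z]
    by (simp add: space_pair_measure)
  have "AE \<omega> in M. prob {\<omega>' \<in> space M. (window J \<omega>, Z 1 \<omega>') \<in> B'} \<le> 1 - c"
    using cond AE_space
  proof eventually_elim
    case (elim \<omega>)
    have "{\<omega>' \<in> space M. Z 1 \<omega>' \<in> Pair (window J \<omega>) -` B} \<in> events"
      using sets_Pair1[OF B] by measurable
    then have "prob (space M - {\<omega>' \<in> space M. (window J \<omega>, Z 1 \<omega>') \<in> B})
        = 1 - prob {\<omega>' \<in> space M. (window J \<omega>, Z 1 \<omega>') \<in> B}"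
      by (intro prob_compl) simp
    moreover have "{\<omega>' \<in> space M. (window J \<omega>, Z 1 \<omega>') \<in> B'}
        = space M - {\<omega>' \<in> space M. (window J \<omega>, Z 1 \<omega>') \<in> B}"
      using elim in_space by (auto simp: B'_def)
    ultimately show ?case using elim by simp
  qed
  from concentrates_upper[OF con B' _ this] \<open>c \<le> 1\<close>
  have "prob {\<omega> \<in> space M. (1 / real (card I)) * (\<Sum>i\<in>I. indicator B' (window J \<omega>, Z i \<omega>)) \<ge> 1 - c + \<epsilon>} \<le> \<delta>"
    by simp
  moreover have "prob {\<omega> \<in> space M. (1 / real (card I)) * (\<Sum>i\<in>I. indicator B' (window J \<omega>, Z i \<omega>)) \<ge> 1 - c + \<epsilon>}
      = prob {\<omega> \<in> space M. (1 / real (card I)) * (\<Sum>i\<in>I. indicator B (window J \<omega>, Z i \<omega>)) \<le> c - \<epsilon>}"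
  proof (intro arg_cong[where f = prob] Collect_cong conj_cong refl)
    fix \<omega> assume "\<omega> \<in> space M"
    then have "(\<Sum>i\<in>I. indicat_real B' (window J \<omega>, Z i \<omega>)) = (\<Sum>i\<in>I. 1 - indicator B (window J \<omega>, Z i \<omega>))"
      using in_space by (intro sum.cong) (auto simp: B'_def indicator_def)
    then have "(1 / real (card I)) * (\<Sum>i\<in>I. indicator B' (window J \<omega>, Z i \<omega>))
        = 1 - (1 / real (card I)) * (\<Sum>i\<in>I. indicator B (window J \<omega>, Z i \<omega>))"
      using I by (simp add: sum_subtractf field_simps)
    then show "1 - c + \<epsilon> \<le> (1 / real (card I)) * (\<Sum>i\<in>I. indicator B' (window J \<omega>, Z i \<omega>))
        \<longleftrightarrow> (1 / real (card I)) * (\<Sum>i\<in>I. indicator B (window J \<omega>, Z i \<omega>)) \<le> c - \<epsilon>"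
      by linarith
  qed
  ultimately show ?thesis by simp
qed

text \<open>\<open>2 * m * a\<close> consecutive points of \<open>I\<close> are retained; the other
  \<open>w\<close> add at most \<open>w / card I\<close> to the frequency. \<open>L\<close> makes
  \<open>exp (- L)\<close> a quarter of what the mixing terms leave of \<delta>.\<close>

lemma concentrates_blocks:
  assumes J: "finite J" "J \<subseteq> {..l}" and k: "l + int r \<le> k"
    and I: "finite I" "(\<lambda>i. k + int i) ` {..<2 * m * a} \<subseteq> I" "card I = 2 * m * a + w"
    and "a > 0" "m > 0"
    and \<delta>: "4 * (real m - 1) * \<beta> a + \<beta> r < \<delta>" "\<delta> < 1"
    and L: "L = ln (4 / (\<delta> - 4 * (real m - 1) * \<beta> a - \<beta> r))"
    and \<epsilon>: "sigma_tilde \<beta> a * sqrt (4 / real (card I) * L) + 1 / (3 * real m) * L + real w / real (card I) \<le> \<epsilon>"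
  shows "concentrates J I \<epsilon> \<delta>"
  unfolding concentrates_def
proof (intro conjI ballI allI impI)
  define n where "n = real (card I)"
  define \<delta>' where "\<delta>' = \<delta> - 4 * (real m - 1) * \<beta> a - \<beta> r"
  define t where "t = 2 * (sigma_tilde \<beta> a * sqrt (2 * real m * real a * L) + real a * L / 3)"
  have mb: "0 \<le> (real m - 1) * \<beta> a" using \<open>m > 0\<close> beta_nonneg[of a] by (intro mult_nonneg_nonneg) auto
  have \<delta>': "0 < \<delta>'" "\<delta>' < 1" using \<delta> mb beta_nonneg[of r] by (simp_all add: \<delta>'_def algebra_simps)
  then have "1 < 4 / \<delta>'" by (simp add: field_simps)
  then have "0 < L" unfolding L \<delta>'_def[symmetric] by (rule ln_gt_zero)
  have expL: "exp (- L) = \<delta>' / 4"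
    using \<delta>' unfolding L \<delta>'_def[symmetric] by (simp add: exp_minus)
  have n: "n = real (2 * m * a) + real w" "0 < n"
    using I \<open>a > 0\<close> \<open>m > 0\<close> by (simp_all add: n_def add_pos_nonneg)
  show "0 \<le> \<epsilon>"
    using \<open>0 < L\<close> sigma_tilde_pos[of a] by (intro order_trans[OF _ \<epsilon>] add_nonneg_nonneg mult_nonneg_nonneg) auto
  \<comment> \<open>The hypothesis on \<epsilon> multiplied by \<open>n\<close>. As
    \<open>2 * m * a\<close> is at most \<open>n\<close>, each deviation term in \<open>t\<close> is
    dominated by \<open>n\<close> times its counterpart.\<close>
  have n\<epsilon>: "t + real w \<le> n * \<epsilon>"
  proof -
    have "2 * sqrt (2 * real m * real a * L) = sqrt (2\<^sup>2 * (2 * real m * real a * L))"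
      by (simp only: real_sqrt_mult[of "2\<^sup>2"]) simp
    also have "2\<^sup>2 * (2 * real m * real a * L) = 4 * real (2 * m * a) * L"
      by simp
    also have "sqrt \<dots> \<le> sqrt (4 * n * L)"
      using \<open>0 < L\<close> n by (intro real_sqrt_le_mono mult_right_mono) auto
    also have "4 * n * L = n\<^sup>2 * (4 / n * L)" using n by (simp add: power2_eq_square)
    also have "sqrt (n\<^sup>2 * (4 / n * L)) = n * sqrt (4 / n * L)"
      unfolding real_sqrt_mult[of "n\<^sup>2"] using n(2) by simp
    finally have "sigma_tilde \<beta> a * (2 * sqrt (2 * real m * real a * L)) \<le> sigma_tilde \<beta> a * (n * sqrt (4 / n * L))"
      using sigma_tilde_pos[of a] by (intro mult_left_mono) auto
    then have 1: "2 * (sigma_tilde \<beta> a * sqrt (2 * real m * real a * L)) \<le> n * (sigma_tilde \<beta> a * sqrt (4 / n * L))"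
      by (simp only: mult.left_commute)
    have "2 * (real a * L / 3) = real (2 * m * a) * (1 / (3 * real m) * L)"
      using \<open>m > 0\<close> by simp
    also have "\<dots> \<le> n * (1 / (3 * real m) * L)"
      using \<open>0 < L\<close> n by (intro mult_right_mono) auto
    finally have 2: "2 * (real a * L / 3) \<le> n * (1 / (3 * real m) * L)" .
    have 3: "n * (sigma_tilde \<beta> a * sqrt (4 / n * L) + 1 / (3 * real m) * L + real w / n) \<le> n * \<epsilon>"
      using \<epsilon> n by (intro mult_left_mono) (auto simp: n_def)
    have 4: "n * (real w / n) = real w" using n(2) by simp
    from 1 2 3 show ?thesis unfolding t_def distrib_left 4 by linarith
  qed
  fix B and c :: real
  assume B [measurable]: "B \<in> sets (PiM J (\<lambda>_. N) \<Otimes>\<^sub>M N)" and "0 \<le> c"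
    and cond: "AE \<omega> in M. prob {\<omega>' \<in> space M. (window J \<omega>, Z 1 \<omega>') \<in> B} \<le> c"
  have "prob {\<omega> \<in> space M. (1 / n) * (\<Sum>i\<in>I. indicator B (window J \<omega>, Z i \<omega>)) \<ge> c + \<epsilon>}
    \<le> prob {\<omega> \<in> space M. (\<Sum>i<2 * m * a. indicator B (window J \<omega>, Z (k + int i) \<omega>)) \<ge> real (2 * m * a) * c + t}"
  proof (intro finite_measure_mono Collect_mono impI conjI; (elim conjE)?)
    fix \<omega>
    assume *: "c + \<epsilon> \<le> (1 / n) * (\<Sum>i\<in>I. indicator B (window J \<omega>, Z i \<omega>))"
    define K where "K = (\<lambda>i. k + int i) ` {..<2 * m * a}"
    have "card K = 2 * m * a" by (simp add: K_def card_image inj_on_def)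
    then have "card (I - K) = w" using I by (simp add: card_Diff_subset K_def)
    then have "(\<Sum>i\<in>I - K. indicat_real B (window J \<omega>, Z i \<omega>)) \<le> real w"
      using sum_bounded_above[of "I - K" "\<lambda>i. indicat_real B (window J \<omega>, Z i \<omega>)" 1] by (simp add: indicator_def)
    moreover have "(\<Sum>i\<in>I. indicat_real B (window J \<omega>, Z i \<omega>))
        = (\<Sum>i\<in>I - K. indicator B (window J \<omega>, Z i \<omega>)) + (\<Sum>i\<in>K. indicator B (window J \<omega>, Z i \<omega>))"
      using I by (intro sum.subset_diff) (auto simp: K_def)
    moreover have "(\<Sum>i\<in>K. indicat_real B (window J \<omega>, Z i \<omega>))
        = (\<Sum>i<2 * m * a. indicator B (window J \<omega>, Z (k + int i) \<omega>))"
      unfolding K_def by (subst sum.reindex) (auto simp: inj_on_def)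
    moreover have "n * c + n * \<epsilon> \<le> (\<Sum>i\<in>I. indicator B (window J \<omega>, Z i \<omega>))"
      using * n(2) by (simp add: field_simps)
    moreover have "real (2 * m * a) * c \<le> n * c"
      using \<open>0 \<le> c\<close> n by (intro mult_right_mono) auto
    ultimately show "real (2 * m * a) * c + t \<le> (\<Sum>i<2 * m * a. indicator B (window J \<omega>, Z (k + int i) \<omega>))"
      using n\<epsilon> by linarith
  qed auto
  also have "\<dots> \<le> \<beta> r + 2 * ((real m - 1) * \<beta> a + exp (- L))"
    unfolding t_def by (rule conditional_deviation[OF J k B]) fact+
  also have "\<dots> \<le> \<delta>"
  proof -
    \<comment> \<open>The left-hand side is \<open>(\<delta> + b) / 2\<close>, and \<open>b\<close>
      is less than \<delta>.\<close>
    have "b + 2 * (x + (\<delta> - 4 * x - b) / 4) \<le> \<delta>" if "0 < \<delta> - 4 * x - b" "0 \<le> x" for x b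
      using that by (simp add: field_simps)
    then show ?thesis
      using \<delta>'(1) mb unfolding expL \<delta>'_def mult.assoc[of 4] by blast
  qed
  finally show "prob {\<omega> \<in> space M. (1 / real (card I)) * (\<Sum>i\<in>I. indicator B (window J \<omega>, Z i \<omega>)) \<ge> c + \<epsilon>} \<le> \<delta>"
    by (simp add: n_def)
qed

end

section \<open>The infima in the calibration and test errors\<close>

text \<open>Bounded parameters leave finitely many values, so the infimum of a nonempty family is a
  minimum. Concentration need then be shown only for one fixed choice of blocks, with no passage to
  a limit.\<close>

lemma Inf_ereal_attained:
  fixes f :: "nat \<Rightarrow> nat \<Rightarrow> nat \<Rightarrow> real"
  assumes "\<And>a m r. P a m r \<Longrightarrow> a \<le> n \<and> m \<le> n \<and> r \<le> n"
  shows "Inf {ereal (f a m r) | a m r. P a m r} = \<infinity>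
    \<or> (\<exists>a m r. P a m r \<and> Inf {ereal (f a m r) | a m r. P a m r} = ereal (f a m r))"
proof -
  let ?F = "{ereal (f a m r) | a m r. P a m r}"
  have "?F \<subseteq> (\<lambda>(a, m, r). ereal (f a m r)) ` ({..n} \<times> {..n} \<times> {..n})"
    using assms by force
  then have "finite ?F" by (rule finite_subset) auto
  show ?thesis
  proof (cases "?F = {}")
    case True
    then show ?thesis by (simp only: Inf_empty top_ereal_def) simp
  next
    case False
    have "Inf ?F \<in> ?F"
      unfolding Min_Inf[OF \<open>finite ?F\<close> False, symmetric] using \<open>finite ?F\<close> False by (rule Min_in)
    then show ?thesis by blast
  qed
qed

lemma image_int_subset:
  assumes "lo \<le> k" "k + int q \<le> hi + 1"
  shows "(\<lambda>i. k + int i) ` {..<q} \<subseteq> {lo..hi}"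
  using assms by auto

context stationary_sequence
begin

text \<open>The first \<open>r - 1\<close> calibration points are dropped, so the retained stretch
  starts \<open>r\<close> steps after the last training time. Dividing by \<open>n - r + 1\<close>
  instead of \<open>n\<close> under the square root only enlarges the bound.\<close>

lemma eps_cal_concentrates:
  assumes "\<delta> < 1"
  shows "eps_cal \<beta> n \<delta> = \<infinity> \<or> (\<exists>e. eps_cal \<beta> n \<delta> = ereal e \<and> concentrates (I_train l) (I_cal l n) e \<delta>)"
proof (cases "eps_cal \<beta> n \<delta> = \<infinity>")
  case False
  define f where "f a m r = sigma_tilde \<beta> a
      * sqrt (4 / (real n - real r + 1) * ln (4 / (\<delta> - 4 * (real m - 1) * \<beta> a - \<beta> r)))
      + 1 / (3 * real m) * ln (4 / (\<delta> - 4 * (real m - 1) * \<beta> a - \<beta> r)) + (real r - 1) / real n" for a m r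
  define P where "P a m r \<longleftrightarrow> a > 0 \<and> m > 0 \<and> r > 0 \<and> int (2 * m * a) = int n - int r + 1 \<and>
      \<delta> > 4 * (real m - 1) * \<beta> a + \<beta> r" for a m r
  have Inf: "eps_cal \<beta> n \<delta> = Inf {ereal (f a m r) | a m r. P a m r}"
    by (simp only: eps_cal_def f_def P_def)
  have P_card: "2 * m * a + (r - 1) = n" "0 < r" if "P a m r" for a m r
    using that unfolding P_def by linarith+
  have "a \<le> n \<and> m \<le> n \<and> r \<le> n" if "P a m r" for a m r
  proof -
    have "0 < a" "0 < m" using that by (auto simp: P_def)
    then have "a \<le> m * a" "m \<le> m * a" "1 \<le> m * a" by auto
    with P_card[OF that] show ?thesis by (simp only: mult.assoc) linarith
  qed
  from Inf_ereal_attained[of P n f, OF this] False Inf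
  obtain a m r where P: "P a m r" and e: "eps_cal \<beta> n \<delta> = ereal (f a m r)" by auto
  define L where "L = ln (4 / (\<delta> - 4 * (real m - 1) * \<beta> a - \<beta> r))"
  have am: "0 < a" "0 < m" and \<delta>: "4 * (real m - 1) * \<beta> a + \<beta> r < \<delta>" using P by (auto simp: P_def)
  have card: "card (I_cal l n) = n" by (simp add: I_cal_def)
  have "concentrates (I_train l) (I_cal l n) (f a m r) \<delta>"
  proof (rule concentrates_blocks[where l = "int l" and k = "int l + int r" and w = "r - 1", OF _ _ _ _ _ _ am \<delta> assms L_def])
    show "(\<lambda>i. int l + int r + int i) ` {..<2 * m * a} \<subseteq> I_cal l n"
      unfolding I_cal_def using P_card[OF P] by (intro image_int_subset) linarith+
    have "0 \<le> (real m - 1) * \<beta> a" using am beta_nonneg by (intro mult_nonneg_nonneg) auto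
    then have "0 < \<delta> - 4 * (real m - 1) * \<beta> a - \<beta> r" "\<delta> - 4 * (real m - 1) * \<beta> a - \<beta> r < 1"
      using \<delta> assms beta_nonneg[of r] by (simp_all add: algebra_simps)
    then have "0 \<le> L" unfolding L_def by (intro ln_ge_zero) (simp add: field_simps)
    have N: "real n - real r + 1 = real (2 * m * a)" using P_card[OF P] by linarith
    have q: "0 < real (2 * m * a)" "real (2 * m * a) \<le> real n"
      using am P_card[OF P] by (simp, linarith)
    then have "0 < real n" by linarith
    with q have "4 / real n * L \<le> 4 / (real n - real r + 1) * L"
      unfolding N using \<open>0 \<le> L\<close>
      by (intro mult_right_mono divide_left_mono mult_pos_pos) simp_all
    then have "sigma_tilde \<beta> a * sqrt (4 / real n * L) \<le> sigma_tilde \<beta> a * sqrt (4 / (real n - real r + 1) * L)"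
      using sigma_tilde_pos[of a] by (intro mult_left_mono real_sqrt_le_mono) auto
    moreover have "real (r - 1) = real r - 1" using P_card[OF P] by simp
    ultimately show "sigma_tilde \<beta> a * sqrt (4 / real (card (I_cal l n)) * L) + 1 / (3 * real m) * L
        + real (r - 1) / real (card (I_cal l n)) \<le> f a m r"
      by (simp add: card f_def L_def)
  qed (use P_card[OF P] card in \<open>auto simp: I_train_def I_cal_def\<close>)
  with e show ?thesis by blast
qed simp

text \<open>The calibration stretch of length \<open>g\<close> serves as the gap, so no test point
  is spent on separation; the last \<open>s\<close> test points are the remainder that the blocks
  leave over.\<close>

lemma eps_test_concentrates:
  assumes "\<delta> < 1"
  shows "eps_test \<beta> g n \<delta> = \<infinity> \<or> (\<exists>e. eps_test \<beta> g n \<delta> = ereal e \<and> concentrates (I_train l) (I_test l g n) e \<delta>)"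
proof (cases "eps_test \<beta> g n \<delta> = \<infinity>")
  case False
  define f where "f a m s = sigma_tilde \<beta> a
      * sqrt (4 / real n * ln (4 / (\<delta> - 4 * (real m - 1) * \<beta> a - \<beta> g)))
      + 1 / (3 * real m) * ln (4 / (\<delta> - 4 * (real m - 1) * \<beta> a - \<beta> g)) + real s / real n" for a m s
  define P where "P a m s \<longleftrightarrow> a > 0 \<and> m > 0 \<and> int (2 * m * a) = int n - int s \<and>
      \<delta> > 4 * (real m - 1) * \<beta> a + \<beta> g" for a m s
  have Inf: "eps_test \<beta> g n \<delta> = Inf {ereal (f a m s) | a m s. P a m s}"
    by (simp only: eps_test_def f_def P_def)
  have P_card: "2 * m * a + s = n" if "P a m s" for a m s
    using that unfolding P_def by linarith
  have "a \<le> n \<and> m \<le> n \<and> s \<le> n" if "P a m s" for a m s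
  proof -
    have "0 < a" "0 < m" using that by (auto simp: P_def)
    then have "a \<le> m * a" "m \<le> m * a" "1 \<le> m * a" by auto
    with P_card[OF that] show ?thesis by (simp only: mult.assoc) linarith
  qed
  from Inf_ereal_attained[of P n f, OF this] False Inf
  obtain a m s where P: "P a m s" and e: "eps_test \<beta> g n \<delta> = ereal (f a m s)" by auto
  have am: "0 < a" "0 < m" and \<delta>: "4 * (real m - 1) * \<beta> a + \<beta> g < \<delta>" using P by (auto simp: P_def)
  have card: "card (I_test l g n) = n" by (simp add: I_test_def)
  have "concentrates (I_train l) (I_test l g n) (f a m s) \<delta>"
  proof (rule concentrates_blocks[where l = "int l" and k = "int l + int g + 1" and w = s, OF _ _ _ _ _ _ am \<delta> assms refl])
    show "(\<lambda>i. int l + int g + 1 + int i) ` {..<2 * m * a} \<subseteq> I_test l g n"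
      unfolding I_test_def using P_card[OF P] by (intro image_int_subset) linarith+
  qed (use P_card[OF P] card in \<open>auto simp: I_train_def I_test_def f_def\<close>)
  with e show ?thesis by blast
qed simp

end

section \<open>Coverage\<close>

locale scored_sequence = stationary_sequence M N Z
  for M :: "'a measure" and N :: "'z measure" and Z +
  fixes J I1 I2 :: "int set" and S :: "(int \<Rightarrow> 'z) \<Rightarrow> 'z \<Rightarrow> real" and \<phi> :: real
  assumes S_measurable: "(\<lambda>(d, z). S d z) \<in> borel_measurable (PiM J (\<lambda>_. N) \<Otimes>\<^sub>M N)"
    and I1: "finite I1" "I1 \<noteq> {}" and I2: "finite I2" "I2 \<noteq> {}"
    and \<phi>: "0 < \<phi>" "\<phi> \<le> 1"
begin

lemma measurable_S [measurable (raw)]: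
  assumes "f \<in> measurable A (PiM J (\<lambda>_. N))" "g \<in> measurable A N"
  shows "(\<lambda>x. S (f x) (g x)) \<in> borel_measurable A"
  using measurable_compose[OF measurable_Pair[OF assms] S_measurable] by simp

definition score :: "int \<Rightarrow> 'a \<Rightarrow> real" where
  "score i \<omega> = S (window J \<omega>) (Z i \<omega>)"

lemma measurable_score [measurable]: "score i \<in> borel_measurable M"
  unfolding score_def[abs_def] by measurable

text \<open>The quantile-free form of \<open>test_coverage\<close>, over the abstract index sets
  \<open>I1\<close> and \<open>I2\<close>.\<close>

definition coverage :: "'a \<Rightarrow> real" where
  "coverage \<omega> = (1 / real (card I2)) * (\<Sum>j\<in>I2.
     of_bool ((1 / real (card I1)) * (\<Sum>i\<in>I1. of_bool (score i \<omega> < score j \<omega>)) < \<phi>))"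

lemma measurable_coverage [measurable]: "coverage \<in> borel_measurable M"
  unfolding coverage_def[abs_def] of_bool_def by measurable

text \<open>With \<open>d\<close> frozen, \<open>Z 1\<close> enters only through the stationary law,
  although time 1 may itself belong to the training data.\<close>

definition cdf_le :: "(int \<Rightarrow> 'z) \<Rightarrow> real \<Rightarrow> real" where
  "cdf_le d x = prob {\<omega> \<in> space M. S d (Z 1 \<omega>) \<le> x}"

definition cdf_less :: "(int \<Rightarrow> 'z) \<Rightarrow> real \<Rightarrow> real" where
  "cdf_less d x = prob {\<omega> \<in> space M. S d (Z 1 \<omega>) < x}"

definition low :: "real \<Rightarrow> ((int \<Rightarrow> 'z) \<times> 'z) set" where
  "low c = {z \<in> space (PiM J (\<lambda>_. N) \<Otimes>\<^sub>M N). cdf_le (fst z) (S (fst z) (snd z)) \<le> c}"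

definition low' :: "real \<Rightarrow> ((int \<Rightarrow> 'z) \<times> 'z) set" where
  "low' c = {z \<in> space (PiM J (\<lambda>_. N) \<Otimes>\<^sub>M N). cdf_less (fst z) (S (fst z) (snd z)) < c}"

lemma measurable_S_section [measurable]:
  "d \<in> space (PiM J (\<lambda>_. N)) \<Longrightarrow> (\<lambda>\<omega>. S d (Z 1 \<omega>)) \<in> borel_measurable M"
  by measurable

lemma sets_low [measurable]: "low c \<in> sets (PiM J (\<lambda>_. N) \<Otimes>\<^sub>M N)"
  unfolding low_def cdf_le_def by measurable

lemma sets_low' [measurable]: "low' c \<in> sets (PiM J (\<lambda>_. N) \<Otimes>\<^sub>M N)"
  unfolding low'_def cdf_less_def by measurable

lemma in_space:
  assumes "\<omega> \<in> space M" "\<omega>' \<in> space M"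
  shows "(window J \<omega>, Z i \<omega>') \<in> space (PiM J (\<lambda>_. N) \<Otimes>\<^sub>M N)"
  using assms measurable_space[OF measurable_window] measurable_space[OF measurable_Z]
  by (simp add: space_pair_measure)

lemma prob_low:
  assumes "\<omega> \<in> space M" "0 \<le> c"
  shows "prob {\<omega>' \<in> space M. (window J \<omega>, Z 1 \<omega>') \<in> low c} \<le> c"
proof -
  have d: "window J \<omega> \<in> space (PiM J (\<lambda>_. N))" using assms measurable_space[OF measurable_window] by blast
  show ?thesis
    using prob_cdf_transform_le[OF measurable_S_section[OF d] assms(2)] in_space[OF assms(1)]
    by (simp add: low_def cdf_le_def cong: conj_cong)
qed

lemma prob_low':
  assumes "\<omega> \<in> space M" "c \<le> 1"
  shows "c \<le> prob {\<omega>' \<in> space M. (window J \<omega>, Z 1 \<omega>') \<in> low' c}"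
proof -
  have d: "window J \<omega> \<in> space (PiM J (\<lambda>_. N))" using assms measurable_space[OF measurable_window] by blast
  show ?thesis
    using prob_cdf_transform_less[OF measurable_S_section[OF d] assms(2)] in_space[OF assms(1)]
    by (simp add: low'_def cdf_less_def cong: conj_cong)
qed

text \<open>Without atoms the distribution function agrees with its left limit, so over this
  training window \<open>low' c\<close> is contained in \<open>low c\<close>, whose probability is
  at most \<open>c\<close>.\<close>

lemma prob_low'_continuous:
  assumes "\<omega> \<in> space M" "0 \<le> c"
    and cont: "\<And>t. prob {\<omega>' \<in> space M. S (window J \<omega>) (Z 1 \<omega>') = t} = 0"
  shows "prob {\<omega>' \<in> space M. (window J \<omega>, Z 1 \<omega>') \<in> low' c} \<le> c"
proof -
  have d [measurable]: "window J \<omega> \<in> space (PiM J (\<lambda>_. N))"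
    using assms measurable_space[OF measurable_window] by blast
  have [measurable]: "(\<lambda>\<omega>'. S (window J \<omega>) (Z 1 \<omega>')) \<in> borel_measurable M"
    by (rule measurable_S_section[OF d])
  have "cdf_le (window J \<omega>) x = cdf_less (window J \<omega>) x" for x
  proof -
    have "cdf_le (window J \<omega>) x = prob ({\<omega>' \<in> space M. S (window J \<omega>) (Z 1 \<omega>') < x}
        \<union> {\<omega>' \<in> space M. S (window J \<omega>) (Z 1 \<omega>') = x})"
      unfolding cdf_le_def by (intro arg_cong[where f = prob]) auto
    also have "\<dots> = cdf_less (window J \<omega>) x"
      unfolding cdf_less_def by (subst finite_measure_Union) (auto simp: cont)
    finally show ?thesis .
  qed
  then have "{\<omega>' \<in> space M. (window J \<omega>, Z 1 \<omega>') \<in> low' c}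
      \<subseteq> {\<omega>' \<in> space M. (window J \<omega>, Z 1 \<omega>') \<in> low c}"
    by (auto simp: low_def low'_def)
  moreover have "{\<omega>' \<in> space M. Z 1 \<omega>' \<in> Pair (window J \<omega>) -` low c} \<in> events"
    using sets_Pair1[OF sets_low] by measurable
  ultimately have "prob {\<omega>' \<in> space M. (window J \<omega>, Z 1 \<omega>') \<in> low' c}
      \<le> prob {\<omega>' \<in> space M. (window J \<omega>, Z 1 \<omega>') \<in> low c}"
    by (intro finite_measure_mono) simp_all
  also have "\<dots> \<le> c" by (rule prob_low) fact+
  finally show ?thesis .
qed

lemma cdf_le_le_cdf_less:
  assumes "d \<in> space (PiM J (\<lambda>_. N))" "x < y"
  shows "cdf_le d x \<le> cdf_less d y"
  unfolding cdf_le_def cdf_less_def using measurable_S_section[OF assms(1)] assms(2)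
  by (intro finite_measure_mono) auto

lemma cdf_less_mono:
  assumes "d \<in> space (PiM J (\<lambda>_. N))" "x \<le> y"
  shows "cdf_less d x \<le> cdf_less d y"
  unfolding cdf_less_def using measurable_S_section[OF assms(1)] assms(2)
  by (intro finite_measure_mono) auto

lemma coverage_bounds: "0 \<le> coverage \<omega>" "coverage \<omega> \<le> 1"
proof -
  show "0 \<le> coverage \<omega>" unfolding coverage_def by (intro mult_nonneg_nonneg sum_nonneg) auto
  have "(\<Sum>j\<in>I2. of_bool ((1 / real (card I1)) * (\<Sum>i\<in>I1. of_bool (score i \<omega> < score j \<omega>)) < \<phi>)) \<le> real (card I2)"
    by (rule order_trans[OF sum_bounded_above[where K = 1]]) auto
  then show "coverage \<omega> \<le> 1" unfolding coverage_def by (simp add: divide_simps)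
qed

text \<open>If few calibration points fall in \<open>low c\<close>, then every test point in \<open>low' c\<close> is covered,
  since all calibration scores below its score lie in \<open>low c\<close>.\<close>

lemma coverage_lower:
  assumes c1: "concentrates J I1 \<epsilon>\<^sub>1 \<delta>\<^sub>1" and c2: "concentrates J I2 \<epsilon>\<^sub>2 \<delta>\<^sub>2"
    and "0 \<le> \<delta>\<^sub>1" "0 \<le> \<delta>\<^sub>2"
  shows "prob {\<omega> \<in> space M. coverage \<omega> < \<phi> - (\<epsilon>\<^sub>1 + \<epsilon>\<^sub>2)} \<le> \<delta>\<^sub>1 + \<delta>\<^sub>2"
proof (cases "\<phi> - \<epsilon>\<^sub>1 \<le> 0")
  \<comment> \<open>The threshold is then nonpositive and coverage is never negative, so the event
    is empty.\<close>
  case True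
  have "0 \<le> \<epsilon>\<^sub>2" using c2 by (simp add: concentrates_def)
  then have "\<not> coverage \<omega> < \<phi> - (\<epsilon>\<^sub>1 + \<epsilon>\<^sub>2)" for \<omega>
    using True coverage_bounds(1)[of \<omega>] by linarith
  then show ?thesis using assms by simp
next
  case False
  define c where "c = \<phi> - \<epsilon>\<^sub>1"
  have c: "0 \<le> c" "c \<le> 1" using False \<phi> c1 by (auto simp: c_def concentrates_def)
  \<comment> \<open>\<open>c\<close> is \<phi> lowered by the calibration error, so outside
    \<open>A1\<close> the calibration frequency of \<open>low c\<close> stays below \<phi>.\<close>
  define A1 where "A1 = {\<omega> \<in> space M. (1 / real (card I1)) * (\<Sum>i\<in>I1. indicator (low c) (window J \<omega>, Z i \<omega>)) \<ge> c + \<epsilon>\<^sub>1}"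
  define A2 where "A2 = {\<omega> \<in> space M. (1 / real (card I2)) * (\<Sum>i\<in>I2. indicator (low' c) (window J \<omega>, Z i \<omega>)) \<le> c - \<epsilon>\<^sub>2}"
  have [measurable]: "A1 \<in> events" "A2 \<in> events" unfolding A1_def A2_def by measurable
  have A1: "prob A1 \<le> \<delta>\<^sub>1"
    unfolding A1_def by (rule concentrates_upper[OF c1 sets_low c(1)]) (auto intro: AE_I2 prob_low c)
  have A2: "prob A2 \<le> \<delta>\<^sub>2"
    unfolding A2_def by (rule concentrates_lower[OF c2 I2 sets_low' c(2)]) (auto intro: AE_I2 prob_low' c)
  have "{\<omega> \<in> space M. coverage \<omega> < \<phi> - (\<epsilon>\<^sub>1 + \<epsilon>\<^sub>2)} \<subseteq> A1 \<union> A2"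
  proof
    fix \<omega> assume \<omega>: "\<omega> \<in> {\<omega> \<in> space M. coverage \<omega> < \<phi> - (\<epsilon>\<^sub>1 + \<epsilon>\<^sub>2)}"
    then have d: "window J \<omega> \<in> space (PiM J (\<lambda>_. N))" using measurable_space[OF measurable_window] by blast
    show "\<omega> \<in> A1 \<union> A2"
    proof (rule ccontr)
      assume "\<omega> \<notin> A1 \<union> A2"
      then have 1: "(1 / real (card I1)) * (\<Sum>i\<in>I1. indicator (low c) (window J \<omega>, Z i \<omega>)) < \<phi>"
        and 2: "c - \<epsilon>\<^sub>2 < (1 / real (card I2)) * (\<Sum>i\<in>I2. indicator (low' c) (window J \<omega>, Z i \<omega>))"
        using \<omega> by (auto simp: A1_def A2_def c_def)
      have "(1 / real (card I2)) * (\<Sum>i\<in>I2. indicator (low' c) (window J \<omega>, Z i \<omega>)) \<le> coverage \<omega>"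
        unfolding coverage_def
      proof (intro mult_left_mono sum_mono)
        fix j
        have dominated: "(1 / real (card I1)) * (\<Sum>i\<in>I1. of_bool (score i \<omega> < score j \<omega>))
          \<le> (1 / real (card I1)) * (\<Sum>i\<in>I1. indicator (low c) (window J \<omega>, Z i \<omega>))"
          if "(window J \<omega>, Z j \<omega>) \<in> low' c"
        proof (intro mult_left_mono sum_mono)
          fix i
          \<comment> \<open>The strict comparison of scores meets the left limit in
            \<open>low'\<close>: the cdf at the smaller score is at most the left limit at the
            larger one.\<close>
          have "cdf_le (window J \<omega>) (score i \<omega>) \<le> c" if "score i \<omega> < score j \<omega>"
            using cdf_le_le_cdf_less[OF d that] \<open>(window J \<omega>, Z j \<omega>) \<in> low' c\<close>
            by (simp add: low'_def score_def)
          then show "of_bool (score i \<omega> < score j \<omega>) \<le> indicat_real (low c) (window J \<omega>, Z i \<omega>)"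
            using \<omega> in_space[of \<omega> \<omega> i] by (auto simp: low_def score_def)
        qed auto
        show "indicat_real (low' c) (window J \<omega>, Z j \<omega>)
          \<le> of_bool ((1 / real (card I1)) * (\<Sum>i\<in>I1. of_bool (score i \<omega> < score j \<omega>)) < \<phi>)"
        proof (cases "(window J \<omega>, Z j \<omega>) \<in> low' c")
          case True
          from le_less_trans[OF dominated[OF True] 1] show ?thesis by simp
        qed simp
      qed auto
      with 2 \<omega> show False by (auto simp: c_def)
    qed
  qed
  then have "prob {\<omega> \<in> space M. coverage \<omega> < \<phi> - (\<epsilon>\<^sub>1 + \<epsilon>\<^sub>2)} \<le> prob (A1 \<union> A2)"
    by (intro finite_measure_mono) auto
  also have "\<dots> \<le> prob A1 + prob A2" by (intro measure_Un_le) auto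
  finally show ?thesis using A1 A2 by simp
qed

text \<open>If at least a fraction \<open>\<phi>\<close> of the calibration points falls in \<open>low' c\<close>, then every covered
  test score is dominated by the score of such a point, hence lies in \<open>low' c\<close> as well.\<close>

lemma coverage_upper:
  assumes c1: "concentrates J I1 \<epsilon>\<^sub>1 \<delta>\<^sub>1" and c2: "concentrates J I2 \<epsilon>\<^sub>2 \<delta>\<^sub>2"
    and "0 \<le> \<delta>\<^sub>1" "0 \<le> \<delta>\<^sub>2"
    and cont: "AE \<omega> in M. \<forall>t. prob {\<omega>' \<in> space M. S (window J \<omega>) (Z 1 \<omega>') = t} = 0"
  shows "prob {\<omega> \<in> space M. coverage \<omega> > \<phi> + (\<epsilon>\<^sub>1 + \<epsilon>\<^sub>2)} \<le> \<delta>\<^sub>1 + \<delta>\<^sub>2"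
proof (cases "\<phi> + \<epsilon>\<^sub>1 \<ge> 1")
  \<comment> \<open>The threshold is then at least 1, which coverage never exceeds.\<close>
  case True
  have "0 \<le> \<epsilon>\<^sub>2" using c2 by (simp add: concentrates_def)
  have "\<not> coverage \<omega> > \<phi> + (\<epsilon>\<^sub>1 + \<epsilon>\<^sub>2)" for \<omega>
    using True \<open>0 \<le> \<epsilon>\<^sub>2\<close> coverage_bounds(2)[of \<omega>] by linarith
  then show ?thesis using assms by simp
next
  case False
  define c where "c = \<phi> + \<epsilon>\<^sub>1"
  have c: "0 \<le> c" "c \<le> 1" using False \<phi> c1 by (auto simp: c_def concentrates_def)
  \<comment> \<open>Both bad events concern \<open>low' c\<close>. The lower bound on its
    probability holds for every law; the upper bound, needed for the test sample, comes from
    continuity.\<close>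
  define A1 where "A1 = {\<omega> \<in> space M. (1 / real (card I1)) * (\<Sum>i\<in>I1. indicator (low' c) (window J \<omega>, Z i \<omega>)) \<le> c - \<epsilon>\<^sub>1}"
  define A2 where "A2 = {\<omega> \<in> space M. (1 / real (card I2)) * (\<Sum>i\<in>I2. indicator (low' c) (window J \<omega>, Z i \<omega>)) \<ge> c + \<epsilon>\<^sub>2}"
  have [measurable]: "A1 \<in> events" "A2 \<in> events" unfolding A1_def A2_def by measurable
  have A1: "prob A1 \<le> \<delta>\<^sub>1"
    unfolding A1_def by (rule concentrates_lower[OF c1 I1 sets_low' c(2)]) (auto intro: AE_I2 prob_low' c)
  have "AE \<omega> in M. prob {\<omega>' \<in> space M. (window J \<omega>, Z 1 \<omega>') \<in> low' c} \<le> c"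
    using cont AE_space by eventually_elim (auto intro: prob_low'_continuous c)
  then have A2: "prob A2 \<le> \<delta>\<^sub>2"
    unfolding A2_def by (rule concentrates_upper[OF c2 sets_low' c(1)])
  have "{\<omega> \<in> space M. coverage \<omega> > \<phi> + (\<epsilon>\<^sub>1 + \<epsilon>\<^sub>2)} \<subseteq> A1 \<union> A2"
  proof
    fix \<omega> assume \<omega>: "\<omega> \<in> {\<omega> \<in> space M. coverage \<omega> > \<phi> + (\<epsilon>\<^sub>1 + \<epsilon>\<^sub>2)}"
    then have d: "window J \<omega> \<in> space (PiM J (\<lambda>_. N))" using measurable_space[OF measurable_window] by blast
    show "\<omega> \<in> A1 \<union> A2"
    proof (rule ccontr)
      assume "\<omega> \<notin> A1 \<union> A2"
      then have 1: "\<phi> < (1 / real (card I1)) * (\<Sum>i\<in>I1. indicator (low' c) (window J \<omega>, Z i \<omega>))"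
        and 2: "(1 / real (card I2)) * (\<Sum>i\<in>I2. indicator (low' c) (window J \<omega>, Z i \<omega>)) < c + \<epsilon>\<^sub>2"
        using \<omega> by (auto simp: A1_def A2_def c_def)
      have "coverage \<omega> \<le> (1 / real (card I2)) * (\<Sum>i\<in>I2. indicator (low' c) (window J \<omega>, Z i \<omega>))"
        unfolding coverage_def
      proof (intro mult_left_mono sum_mono)
        fix j
        have dominated: "(1 / real (card I1)) * (\<Sum>i\<in>I1. indicator (low' c) (window J \<omega>, Z i \<omega>))
          \<le> (1 / real (card I1)) * (\<Sum>i\<in>I1. of_bool (score i \<omega> < score j \<omega>))"
          if "(window J \<omega>, Z j \<omega>) \<notin> low' c"
        proof (intro mult_left_mono sum_mono)
          fix i
          \<comment> \<open>Contrapositively, a calibration point in \<open>low' c\<close> has a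
            score strictly below that of \<open>j\<close>, which lies outside.\<close>
          have "cdf_less (window J \<omega>) (score i \<omega>) \<ge> c" if "score j \<omega> \<le> score i \<omega>"
            using cdf_less_mono[OF d that] \<open>(window J \<omega>, Z j \<omega>) \<notin> low' c\<close> \<omega> in_space[of \<omega> \<omega> j]
            by (simp add: low'_def score_def)
          then show "indicat_real (low' c) (window J \<omega>, Z i \<omega>) \<le> of_bool (score i \<omega> < score j \<omega>)"
            by (auto simp: low'_def score_def indicator_def not_less not_le[symmetric])
        qed auto
        show "of_bool ((1 / real (card I1)) * (\<Sum>i\<in>I1. of_bool (score i \<omega> < score j \<omega>)) < \<phi>)
            \<le> indicat_real (low' c) (window J \<omega>, Z j \<omega>)"
        proof (cases "(window J \<omega>, Z j \<omega>) \<in> low' c")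
          case False
          from less_le_trans[OF 1 dominated[OF False]] show ?thesis by simp
        qed simp
      qed auto
      with 2 \<omega> show False by (auto simp: c_def)
    qed
  qed
  then have "prob {\<omega> \<in> space M. coverage \<omega> > \<phi> + (\<epsilon>\<^sub>1 + \<epsilon>\<^sub>2)} \<le> prob (A1 \<union> A2)"
    by (intro finite_measure_mono) auto
  also have "\<dots> \<le> prob A1 + prob A2" by (intro measure_Un_le) auto
  finally show ?thesis using A1 A2 by simp
qed

end

theorem theorem3p2:
  fixes M :: "'a measure" and MX :: "'x measure" and MY :: "'y measure"
    and Z :: "int \<Rightarrow> 'a \<Rightarrow> 'x \<times> 'y" and Zs :: "'a \<Rightarrow> 'x \<times> 'y"
    and s :: "(int \<Rightarrow> 'x \<times> 'y) \<Rightarrow> 'x \<times> 'y \<Rightarrow> real"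
    and ntr ncal nte :: nat and \<alpha> \<delta>cal \<delta>test :: real
  assumes "prob_space M"
    and mix: "beta_mixing_process M (MX \<Otimes>\<^sub>M MY) Z"
    and "ntr > 0" "ncal > 0" "nte > 0"
    and Zs_meas: "Zs \<in> measurable M (MX \<Otimes>\<^sub>M MY)"
    and Zs_distr: "distr M (MX \<Otimes>\<^sub>M MY) Zs = distr M (MX \<Otimes>\<^sub>M MY) (Z 1)"
    and Zs_indep: "distr M (PiM {1 .. int (ntr + ncal + nte)} (\<lambda>_. MX \<Otimes>\<^sub>M MY) \<Otimes>\<^sub>M (MX \<Otimes>\<^sub>M MY))
                     (\<lambda>\<omega>. (\<lambda>i\<in>{1 .. int (ntr + ncal + nte)}. Z i \<omega>, Zs \<omega>))
                   = distr M (PiM {1 .. int (ntr + ncal + nte)} (\<lambda>_. MX \<Otimes>\<^sub>M MY))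
                       (\<lambda>\<omega>. \<lambda>i\<in>{1 .. int (ntr + ncal + nte)}. Z i \<omega>)
                     \<Otimes>\<^sub>M distr M (MX \<Otimes>\<^sub>M MY) Zs"
    and s_meas: "(\<lambda>(d, z). s d z) \<in> borel_measurable
                    (PiM (I_train ntr) (\<lambda>_. MX \<Otimes>\<^sub>M MY) \<Otimes>\<^sub>M (MX \<Otimes>\<^sub>M MY))"
    and "0 < \<alpha>" "\<alpha> < 1" "\<delta>cal > 0" "\<delta>test > 0"
  defines "\<eta> \<equiv> eps_cal (beta_coeff M (MX \<Otimes>\<^sub>M MY) Z) ncal \<delta>cal + eps_test (beta_coeff M (MX \<Otimes>\<^sub>M MY) Z) ncal nte \<delta>test"
  shows "(measure M {\<omega> \<in> space M.
            ereal (test_coverage s Z ntr ncal nte (1 - \<alpha>) \<omega>) \<ge> ereal (1 - \<alpha>) - \<eta>}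
           \<ge> 1 - \<delta>cal - \<delta>test)
       \<and> ((AE d in distr M (PiM (I_train ntr) (\<lambda>_. MX \<Otimes>\<^sub>M MY)) (\<lambda>\<omega>. \<lambda>i\<in>I_train ntr. Z i \<omega>).
            \<forall>t. measure M {\<omega> \<in> space M. s d (Zs \<omega>) = t} = 0)
         \<longrightarrow> measure M {\<omega> \<in> space M.
            ereal \<bar>test_coverage s Z ntr ncal nte (1 - \<alpha>) \<omega> - (1 - \<alpha>)\<bar> \<le> \<eta>}
           \<ge> 1 - 2 * \<delta>cal - 2 * \<delta>test)"
proof -
  interpret prob_space M by fact
  let ?N = "MX \<Otimes>\<^sub>M MY" and ?J = "I_train ntr" and ?I1 = "I_cal ntr ncal" and ?I2 = "I_test ntr ncal nte"
  have \<phi>: "0 < 1 - \<alpha>" "1 - \<alpha> \<le> 1" using assms by auto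
  have card: "card ?I1 = ncal" "card ?I2 = nte" by (simp_all add: I_cal_def I_test_def)
  have fin: "finite ?I1" "finite ?I2" by (simp_all add: I_cal_def I_test_def)
  interpret scored_sequence M ?N Z ?J ?I1 ?I2 s "1 - \<alpha>"
  proof
    show "stationary_process M ?N Z" using mix by (simp add: beta_mixing_process_def)
    show "?I1 \<noteq> {}" "?I2 \<noteq> {}" using card \<open>ncal > 0\<close> \<open>nte > 0\<close> by force+
  qed (use fin s_meas \<phi> in auto)
  have cov: "test_coverage s Z ntr ncal nte (1 - \<alpha>) \<omega> = coverage \<omega>" for \<omega>
    by (simp add: test_coverage_eq[OF \<phi>(1)] coverage_def score_def s_hat_def card window_def)
  \<comment> \<open>\<open>Zs\<close> and \<open>Z 1\<close> have the same law, so the continuity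
    hypothesis passes to \<open>Z 1\<close>, in terms of which the distribution functions are
    defined.\<close>
  have Z1: "measure M {\<omega> \<in> space M. s d (Zs \<omega>) = t} = measure M {\<omega> \<in> space M. s d (Z 1 \<omega>) = t}"
    if "d \<in> space (PiM ?J (\<lambda>_. ?N))" for d t
  proof -
    have [measurable]: "(\<lambda>z. s d z) \<in> borel_measurable ?N" using that by measurable
    have "{z \<in> space ?N. s d z = t} \<in> sets ?N" by measurable
    then have "measure (distr M ?N X) {z \<in> space ?N. s d z = t} = measure M {\<omega> \<in> space M. s d (X \<omega>) = t}"
      if "X \<in> measurable M ?N" for X
      using that measurable_space[OF that] by (subst measure_distr) (auto intro!: arg_cong[where f = "measure M"])
    from this[OF Zs_meas] this[OF measurable_Z[of 1]] show ?thesis by (simp add: Zs_distr)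
  qed
  show ?thesis
  proof (cases "\<delta>cal < 1 \<and> \<delta>test < 1 \<and> \<eta> \<noteq> \<infinity>")
    \<comment> \<open>If \<eta> is infinite, both events are the whole space. Otherwise
      \<open>\<delta>cal\<close> or \<open>\<delta>test\<close> is at least 1, and the claimed lower
      bounds are not positive.\<close>
    case trivial: False
    show ?thesis
    proof (cases "\<eta> = \<infinity>")
      case True
      then show ?thesis
        using \<open>\<delta>cal > 0\<close> \<open>\<delta>test > 0\<close> by (simp add: prob_space)
    next
      case False
      with trivial have "1 \<le> \<delta>cal + \<delta>test" using \<open>\<delta>cal > 0\<close> \<open>\<delta>test > 0\<close> by linarith
      then have "1 - \<delta>cal - \<delta>test \<le> 0" "1 - 2 * \<delta>cal - 2 * \<delta>test \<le> 0" by linarith+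
      then show ?thesis using measure_nonneg order_trans by blast
    qed
  next
    case True
    then obtain e1 e2 where e: "eps_cal \<beta> ncal \<delta>cal = ereal e1" "eps_test \<beta> ncal nte \<delta>test = ereal e2"
      and con: "concentrates ?J ?I1 e1 \<delta>cal" "concentrates ?J ?I2 e2 \<delta>test"
      using eps_cal_concentrates[of \<delta>cal ncal ntr] eps_test_concentrates[of \<delta>test ncal nte ntr]
      by (auto simp: \<eta>_def)
    have \<eta>: "\<eta> = ereal (e1 + e2)" by (simp add: \<eta>_def e)
    define A where "A = {\<omega> \<in> space M. coverage \<omega> < 1 - \<alpha> - (e1 + e2)}"
    define B where "B = {\<omega> \<in> space M. coverage \<omega> > 1 - \<alpha> + (e1 + e2)}"
    have [measurable]: "A \<in> events" "B \<in> events" unfolding A_def B_def by measurable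
    have A: "prob A \<le> \<delta>cal + \<delta>test"
      unfolding A_def using con assms by (intro coverage_lower) auto
    have "{\<omega> \<in> space M. ereal (test_coverage s Z ntr ncal nte (1 - \<alpha>) \<omega>) \<ge> ereal (1 - \<alpha>) - \<eta>} = space M - A"
      by (auto simp: cov \<eta> A_def)
    then have lower: "measure M {\<omega> \<in> space M. ereal (test_coverage s Z ntr ncal nte (1 - \<alpha>) \<omega>) \<ge> ereal (1 - \<alpha>) - \<eta>}
        \<ge> 1 - \<delta>cal - \<delta>test"
      using A by (simp add: prob_compl)
    have "measure M {\<omega> \<in> space M. ereal \<bar>test_coverage s Z ntr ncal nte (1 - \<alpha>) \<omega> - (1 - \<alpha>)\<bar> \<le> \<eta>}
        \<ge> 1 - 2 * \<delta>cal - 2 * \<delta>test"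
      if cont: "AE d in distr M (PiM ?J (\<lambda>_. ?N)) (\<lambda>\<omega>. \<lambda>i\<in>?J. Z i \<omega>).
            \<forall>t. measure M {\<omega> \<in> space M. s d (Zs \<omega>) = t} = 0"
    proof -
      have "AE \<omega> in M. \<forall>t. measure M {\<omega>' \<in> space M. s (window ?J \<omega>) (Zs \<omega>') = t} = 0"
        using AE_distrD[OF measurable_window cont[folded window_def]] .
      then have "AE \<omega> in M. \<forall>t. prob {\<omega>' \<in> space M. s (window ?J \<omega>) (Z 1 \<omega>') = t} = 0"
        using AE_space by eventually_elim (simp add: Z1 measurable_space[OF measurable_window])
      then have B: "prob B \<le> \<delta>cal + \<delta>test"
        unfolding B_def using con assms by (intro coverage_upper) auto
      \<comment> \<open>The two-sided event fails exactly on \<open>A\<close> or \<open>B\<close>,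
        each of probability at most \<open>\<delta>cal + \<delta>test\<close>, which doubles the
        loss.\<close>
      have "{\<omega> \<in> space M. ereal \<bar>test_coverage s Z ntr ncal nte (1 - \<alpha>) \<omega> - (1 - \<alpha>)\<bar> \<le> \<eta>} = space M - (A \<union> B)"
        by (auto simp: cov \<eta> A_def B_def abs_le_iff)
      moreover have "prob (A \<union> B) \<le> prob A + prob B" by (intro measure_Un_le) auto
      ultimately show ?thesis using A B by (simp add: prob_compl)
    qed
    with lower show ?thesis by blast
  qed
qed

end
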